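(* Let $p<2$ and $f(t)=t^{p-1}$ for $t>0$. Let $0=t_0<t_1<\dots<t_k$ be such that $a(t_i)=0$ for $i=1,\dots,k$ and $a>0$ on $(t_i,t_{i+1})$ for $i=0,\dots,k-1$. Let $g$ be homogeneous of degree $\gamma>0$, i.e. $g(tu)=t^\gamma g(u)$ for all $t>0$ and $u\in C^1_0(\overline\Omega)$. Let $v$ be a positive solution of $$-\Delta v=v^{p-1}\ \text{in }\Omega,\qquad v=0\ \text{on }\partial\Omega,$$ $C_v:=g(v)$, and for $i=0,\dots,k-1$ set $$\lambda_{0,i}:=C_v^{\frac{p-2}{\gamma}}\max_{\alpha\in[t_i,t_{i+1}]}a(\alpha)\,\alpha^{\frac{2-p}{\gamma}} .$$ Then, for each $i=0,\dots,k-1$: (i) If $0<\lambda<\lambda_{0,i}$, then $(\mathcal P_g)$ has at least two solutions $u_{1,i},u_{2,i}$ in $(t_i,t_{i+1})$. (ii) If $\lambda=\lambda_{0,i}$, then $(\mathcal P_g)$ has at least one solution $u_i$ in $(t_i,t_{i+1})$. (iii) If $\lambda>\lambda_{0,i}$, then $(\mathcal P_g)$ has no solution in $(t_i,t_{i+1})$. If moreover either $a$ or $\alpha\mapsto\alpha^{\frac{2-p}{\gamma}}a(\alpha)$ is strictly concave in $(t_i,t_{i+1})$, then (i) and (ii) hold with "at least" replaced by "exactly".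
   Context: $\Omega\subset\mathbb R^N$ is a bounded smooth domain, $C^1_0(\overline\Omega)=\{u\in C^1(\overline\Omega):u=0\text{ on }\partial\Omega\}$. The function $a:[0,\infty)\to[0,\infty)$ is continuous. The functional $g:C^1_0(\overline\Omega)\to[0,\infty)$ is continuous with $g(0)=0$, and satisfies at least one of: $(g_1)$ whenever $(u_n)\subset C^1_0(\overline\Omega)$ satisfies $|u_n(x)|\to\infty$ for all $x$ in some subset of $\Omega$ of positive measure, $g(u_n)\to\infty$; $(g_2)$ whenever $(u_n)\subset C^1_0(\overline\Omega)$ satisfies $|\nabla u_n(x)|\to\infty$ for all $x$ in some subset of $\Omega$ of positive measure, $g(u_n)\to\infty$. (In particular $C_v>0$.) For $\lambda>0$, $(\mathcal P_g)$ is the problem $$-a(g(u))\,\Delta u=\lambda f(u)\ \text{in }\Omega,\qquad u>0\ \text{in }\Omega,\qquad u=0\ \text{on }\partial\Omega .$$ Solutions (both of $(\mathcal P_g)$ and of the equation for $v$) are functions in $C^1_0(\overline\Omega)$, positive in $\Omega$, satisfying the equation in the weak (distributional) sense. A solution in $(t_i,t_{i+1})$ is a solution $u$ with $t_i<g(u)<t_{i+1}$. *)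

theory Defs
  imports "HOL-Analysis.Analysis"
begin

definition grad :: "('a::euclidean_space \<Rightarrow> real) \<Rightarrow> 'a \<Rightarrow> 'a" where
  "grad u x = (THE D. GDERIV u x :> D)"

text \<open>The class $C^n(\mathbb R^N)$ of real-valued functions, by recursion on \<open>n\<close>.\<close>

primrec Cn :: "nat \<Rightarrow> ('a::euclidean_space \<Rightarrow> real) \<Rightarrow> bool" where
  "Cn 0 f \<longleftrightarrow> continuous_on UNIV f"
| "Cn (Suc n) f \<longleftrightarrow> (\<forall>x. f differentiable (at x)) \<and> (\<forall>b\<in>Basis. Cn n (\<lambda>x. grad f x \<bullet> b))"

definition smooth :: "('a::euclidean_space \<Rightarrow> real) \<Rightarrow> bool" where
  "smooth f \<longleftrightarrow> (\<forall>n. Cn n f)"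

text \<open>A bounded domain whose boundary is locally the graph of a $C^\infty$ function, with the
  domain on one side of it. Near a boundary point, \<open>e\<close> is the direction of the last axis of a
  rotated orthonormal frame; \<open>h\<close> is evaluated only at points orthogonal to \<open>e\<close>, so it plays the
  role of a smooth function of the other $N-1$ coordinates.\<close>

definition bounded_smooth_domain :: "'a::euclidean_space set \<Rightarrow> bool" where
  "bounded_smooth_domain \<Omega> \<longleftrightarrow>
     open \<Omega> \<and> connected \<Omega> \<and> \<Omega> \<noteq> {} \<and> bounded \<Omega> \<and>
     (\<forall>x\<in>frontier \<Omega>. \<exists>r>0. \<exists>e h. norm e = 1 \<and> smooth h \<and>
        (\<forall>y\<in>ball x r. y \<in> \<Omega> \<longleftrightarrow> h (y - (y \<bullet> e) *\<^sub>R e) < y \<bullet> e))"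

text \<open>$C^1_0(\overline\Omega)$. Its elements are represented by their extensions by zero, so that
  equality of elements is equality of HOL functions. Being $C^1$ up to the boundary means that
  the gradient in \<open>\<Omega>\<close> extends continuously to the closure.\<close>

definition C10 :: "'a::euclidean_space set \<Rightarrow> ('a \<Rightarrow> real) set" where
  "C10 \<Omega> = {u. continuous_on (closure \<Omega>) u \<and> (\<forall>x. x \<notin> \<Omega> \<longrightarrow> u x = 0) \<and>
      (\<exists>G. continuous_on (closure \<Omega>) G \<and> (\<forall>x\<in>\<Omega>. GDERIV u x :> G x))}"

definition C1_norm :: "'a::euclidean_space set \<Rightarrow> ('a \<Rightarrow> real) \<Rightarrow> real" where
  "C1_norm \<Omega> u = (SUP x\<in>\<Omega>. \<bar>u x\<bar>) + (SUP x\<in>\<Omega>. norm (grad u x))"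

definition continuous_functional ::
  "'a::euclidean_space set \<Rightarrow> (('a \<Rightarrow> real) \<Rightarrow> real) \<Rightarrow> bool" where
  "continuous_functional \<Omega> g \<longleftrightarrow>
     (\<forall>u\<in>C10 \<Omega>. \<forall>\<epsilon>>0. \<exists>\<delta>>0. \<forall>w\<in>C10 \<Omega>.
        C1_norm \<Omega> (\<lambda>x. w x - u x) < \<delta> \<longrightarrow> \<bar>g w - g u\<bar> < \<epsilon>)"

definition cond_g1 :: "'a::euclidean_space set \<Rightarrow> (('a \<Rightarrow> real) \<Rightarrow> real) \<Rightarrow> bool" where
  "cond_g1 \<Omega> g \<longleftrightarrow>
     (\<forall>u :: nat \<Rightarrow> 'a \<Rightarrow> real. (\<forall>n. u n \<in> C10 \<Omega>) \<longrightarrow>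
        (\<exists>S \<in> sets lebesgue. S \<subseteq> \<Omega> \<and> emeasure lebesgue S > 0 \<and>
           (\<forall>x\<in>S. filterlim (\<lambda>n. \<bar>u n x\<bar>) at_top sequentially)) \<longrightarrow>
        filterlim (\<lambda>n. g (u n)) at_top sequentially)"

definition cond_g2 :: "'a::euclidean_space set \<Rightarrow> (('a \<Rightarrow> real) \<Rightarrow> real) \<Rightarrow> bool" where
  "cond_g2 \<Omega> g \<longleftrightarrow>
     (\<forall>u :: nat \<Rightarrow> 'a \<Rightarrow> real. (\<forall>n. u n \<in> C10 \<Omega>) \<longrightarrow>
        (\<exists>S \<in> sets lebesgue. S \<subseteq> \<Omega> \<and> emeasure lebesgue S > 0 \<and>
           (\<forall>x\<in>S. filterlim (\<lambda>n. norm (grad (u n) x)) at_top sequentially)) \<longrightarrow>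
        filterlim (\<lambda>n. g (u n)) at_top sequentially)"

text \<open>The test functions $C_c^\infty(\Omega)$.\<close>

definition test_fun :: "'a::euclidean_space set \<Rightarrow> ('a \<Rightarrow> real) \<Rightarrow> bool" where
  "test_fun \<Omega> \<phi> \<longleftrightarrow> smooth \<phi> \<and>
     compact (closure {x. \<phi> x \<noteq> 0}) \<and> closure {x. \<phi> x \<noteq> 0} \<subseteq> \<Omega>"

text \<open>\<open>u\<close> is a positive weak solution of $-c\,\Delta u = F(u)$ in \<open>\<Omega>\<close>, $u = 0$ on
  $\partial\Omega$. For \<open>F\<close> continuous on $(0,\infty)$ (possibly singular at \<open>0\<close>) both integrands
  are continuous with compact support in \<open>\<Omega>\<close>, so both integrals converge.\<close>

definition pos_weak_solution ::
  "'a::euclidean_space set \<Rightarrow> real \<Rightarrow> (real \<Rightarrow> real) \<Rightarrow> ('a \<Rightarrow> real) \<Rightarrow> bool" where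
  "pos_weak_solution \<Omega> c F u \<longleftrightarrow>
     u \<in> C10 \<Omega> \<and> (\<forall>x\<in>\<Omega>. u x > 0) \<and>
     (\<forall>\<phi>. test_fun \<Omega> \<phi> \<longrightarrow>
        c * (LINT x:\<Omega>|lborel. grad u x \<bullet> grad \<phi> x) = (LINT x:\<Omega>|lborel. F (u x) * \<phi> x))"

text \<open>The problem $(\mathcal P_g)$: $-a(g(u))\,\Delta u = \lambda f(u)$.\<close>

definition solves_Pg ::
  "'a::euclidean_space set \<Rightarrow> (real \<Rightarrow> real) \<Rightarrow> (('a \<Rightarrow> real) \<Rightarrow> real) \<Rightarrow> real \<Rightarrow> (real \<Rightarrow> real) \<Rightarrow>
   ('a \<Rightarrow> real) \<Rightarrow> bool" where
  "solves_Pg \<Omega> a g lam f u \<longleftrightarrow> pos_weak_solution \<Omega> (a (g u)) (\<lambda>s. lam * f s) u"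

definition strictly_concave_on :: "real set \<Rightarrow> (real \<Rightarrow> real) \<Rightarrow> bool" where
  "strictly_concave_on S h \<longleftrightarrow> convex S \<and>
     (\<forall>x\<in>S. \<forall>y\<in>S. \<forall>\<theta>. x \<noteq> y \<and> 0 < \<theta> \<and> \<theta> < 1 \<longrightarrow>
        (1 - \<theta>) * h x + \<theta> * h y < h ((1 - \<theta>) * x + \<theta> * y))"

text \<open>The threshold $\lambda_{0,i}$, with \<open>l = t i\<close>, \<open>r = t (i + 1)\<close>. For \<open>a\<close> continuous and
  \<open>p < 2\<close> the supremum is a maximum over a compact interval; \<open>0 powr _ = 0\<close> is the right value
  at \<open>\<alpha> = 0\<close> because the exponent is positive.\<close>

definition lambda0 ::
  "real \<Rightarrow> real \<Rightarrow> (real \<Rightarrow> real) \<Rightarrow> real \<Rightarrow> real \<Rightarrow> real \<Rightarrow> real" where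
  "lambda0 p \<gamma> a C l r =
     C powr ((p - 2) / \<gamma>) * (SUP \<alpha>\<in>{l..r}. a \<alpha> * \<alpha> powr ((2 - p) / \<gamma>))"

end

theory Submission
  imports Defs
begin

text \<open>
  The equation is homogeneous along rays. If \<open>u\<close> solves the problem and \<open>g u = \<alpha>\<close>, then
  \<open>- a \<alpha> \<Delta>u = lam * u powr (p - 1)\<close> has a constant coefficient on the left, and a suitable positive
  multiple of \<open>u\<close> solves the model equation \<open>- \<Delta>v = v powr (p - 1)\<close>. As the latter has only one
  positive solution \<open>v\<close>, every solution is a multiple \<open>s * v\<close>. Homogeneity of \<open>g\<close> gives
  \<open>s = (\<alpha> / g v) powr (1 / \<gamma>)\<close>, and comparing the two equations gives \<open>lam = H \<alpha>\<close> with
  \<open>H \<alpha> = g v powr ((p - 2) / \<gamma>) * (a \<alpha> * \<alpha> powr ((2 - p) / \<gamma>))\<close> (lemma \<open>solution_ray\<close>). So, for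
  \<open>lam > 0\<close>, the solutions in \<open>(t i, t (i + 1))\<close> correspond bijectively to the points \<open>\<alpha>\<close> of that interval with
  \<open>H \<alpha> = lam\<close>. The function \<open>H\<close> is continuous, positive inside and zero at both ends, with maximum
  \<open>lam0\<close>; the intermediate value theorem and strict concavity then count these points.

  The analytic core is uniqueness for the model equation (\<open>pos_weak_solution_unique\<close>), with
  solutions that are merely \<open>C\<^sup>1\<close> and a nonlinearity that may be singular at \<open>0\<close>. If \<open>u\<close> exceeds
  \<open>w\<close> somewhere, choose \<open>q \<in> (0, 1)\<close> with \<open>q < 2 - p\<close> and a point \<open>x0\<close> maximising
  \<open>u powr q - w powr q\<close>; it is interior because both functions vanish on the boundary. The function
  \<open>s \<mapsto> (M + s powr q) powr (1 / q)\<close> is concave, so replacing it by its tangent shows that the linear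
  combination \<open>W = u - \<kappa> * w\<close> with \<open>\<kappa> = (u x0 / w x0) powr (1 - q)\<close> is also maximal at \<open>x0\<close>. But
  \<open>- \<Delta>W = u powr (p - 1) - \<kappa> * w powr (p - 1)\<close> is negative at \<open>x0\<close>, by the choice of \<open>q\<close>.

  This contradicts a maximum principle for weak solutions (\<open>weak_maximum_imp_source_nonneg\<close>): where
  \<open>- \<Delta>W < 0\<close>, weighted means of \<open>W\<close> over balls about \<open>x0\<close> strictly increase with the radius, since
  the derivative of the mean in the radius is \<open>\<integral> \<nabla>W \<bullet> \<nabla>\<phi>\<close> for a radial bump \<open>\<phi>\<close>, up to a negative
  factor.
\<close>

section \<open>Smooth radial bumps\<close>

text \<open>
  The usual flat function \<open>exp (- 1 / s)\<close>, together with its products with powers of \<open>1 / s\<close>: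
  the span of this family is closed under differentiation.
\<close>

definition flat_exp :: "nat \<Rightarrow> real \<Rightarrow> real" where
  "flat_exp k s = (if s \<le> 0 then 0 else exp (- inverse s) * inverse s ^ k)"

lemma flat_exp_nonneg: "flat_exp k s \<ge> 0"
  by (simp add: flat_exp_def)

lemma flat_exp_tendsto_0: "(flat_exp k \<longlongrightarrow> 0) (at 0)"
proof -
  have "((\<lambda>s. inverse s ^ k / exp (inverse s)) \<longlongrightarrow> (0::real)) (at_right 0)"
    by (rule filterlim_compose[OF tendsto_power_div_exp_0 filterlim_inverse_at_top_right])
  then have R: "(flat_exp k \<longlongrightarrow> 0) (at_right 0)"
    by (rule Lim_transform_eventually)
       (auto simp: eventually_at_filter flat_exp_def exp_minus field_simps)
  have "((\<lambda>_. 0) \<longlongrightarrow> (0::real)) (at_left 0)"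
    by simp
  then have L: "(flat_exp k \<longlongrightarrow> 0) (at_left 0)"
    by (rule Lim_transform_eventually) (auto simp: eventually_at_filter flat_exp_def)
  show ?thesis
    using L R by (simp add: filterlim_split_at_real)
qed

lemma DERIV_flat_exp:
  "DERIV (flat_exp k) s :> flat_exp (k + 2) s - real k * flat_exp (k + 1) s"
proof -
  consider "s < 0" | "s = 0" | "s > 0" by linarith
  then show ?thesis
  proof cases
    case 1
    have "DERIV (\<lambda>_. 0::real) s :> 0" by simp
    then have "DERIV (flat_exp k) s :> 0"
      by (rule has_field_derivative_transform_within_open[of _ _ _ "{..<0}"])
         (use 1 in \<open>auto simp: flat_exp_def\<close>)
    then show ?thesis using 1 by (simp add: flat_exp_def)
  next
    case 2
    have "((\<lambda>h. (flat_exp k (0 + h) - flat_exp k 0) / h) \<longlongrightarrow> 0) (at 0)"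
      using flat_exp_tendsto_0[of "Suc k"]
      by (rule Lim_transform_eventually)
         (auto simp: eventually_at_filter flat_exp_def field_simps)
    then show ?thesis using 2 by (simp add: DERIV_def flat_exp_def)
  next
    case 3
    have "DERIV (\<lambda>s. exp (- inverse s) * inverse s ^ k) s :>
        exp (- inverse s) * (inverse s * inverse s) * inverse s ^ k
        + exp (- inverse s) * (real k * inverse s ^ (k - 1) * - ((inverse s * inverse s)))"
      using 3 by (auto intro!: derivative_eq_intros simp: power2_eq_square mult_ac)
    also have "real k * inverse s ^ (k - 1) * - ((inverse s * inverse s)) = - (real k * inverse s ^ (k + 1))"
      by (cases k) (simp_all add: power2_eq_square)
    also have "exp (- inverse s) * (inverse s * inverse s) * inverse s ^ k
        + exp (- inverse s) * - (real k * inverse s ^ (k + 1))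
        = flat_exp (k + 2) s - real k * flat_exp (k + 1) s"
      using 3 by (simp add: flat_exp_def power_add algebra_simps)
    finally have "DERIV (\<lambda>s. exp (- inverse s) * inverse s ^ k) s :>
        flat_exp (k + 2) s - real k * flat_exp (k + 1) s" .
    then show ?thesis
      by (rule has_field_derivative_transform_within_open[of _ _ _ "{0<..}"])
         (use 3 in \<open>auto simp: flat_exp_def\<close>)
  qed
qed

lemma GDERIV_unique:
  assumes "GDERIV f x :> A" "GDERIV f x :> B" shows "A = B"
proof -
  have "(\<lambda>h. h \<bullet> A) = (\<lambda>h. h \<bullet> B)"
    using assms unfolding gderiv_def by (rule has_derivative_unique)
  then have "h \<bullet> A = h \<bullet> B" for h
    by (rule fun_cong)
  then show ?thesis
    using inner_eq_zero_iff[of "A - B"] by (simp add: inner_diff_right)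
qed

lemma grad_eq: "GDERIV f x :> D \<Longrightarrow> grad f x = D"
  unfolding grad_def by (rule the_equality) (auto intro: GDERIV_unique)

text \<open>
  A space of functions closed under partial derivatives that contains the bump of centre \<open>c\<close> and
  radius \<open>r\<close>. Closure under multiplication by coordinates is what the chain rule asks for, as the
  gradient of \<open>(x - c) \<bullet> (x - c)\<close> is \<open>2 (x - c)\<close>. Smoothness of all members then needs no formula
  for higher derivatives.
\<close>

inductive bump_algebra :: "'a::euclidean_space \<Rightarrow> real \<Rightarrow> ('a \<Rightarrow> real) \<Rightarrow> bool" for c r where
  profile: "bump_algebra c r (\<lambda>x. flat_exp k (1 - ((x - c) \<bullet> (x - c)) / r\<^sup>2))"
| coord: "bump_algebra c r f \<Longrightarrow> bump_algebra c r (\<lambda>x. ((x - c) \<bullet> b) * f x)"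
| scale: "bump_algebra c r f \<Longrightarrow> bump_algebra c r (\<lambda>x. m * f x)"
| add: "bump_algebra c r f \<Longrightarrow> bump_algebra c r g \<Longrightarrow> bump_algebra c r (\<lambda>x. f x + g x)"

lemma GDERIV_flat_exp_radial:
  fixes c :: "'a::euclidean_space"
  shows "GDERIV (\<lambda>x. flat_exp k (1 - ((x - c) \<bullet> (x - c)) / r\<^sup>2)) x :>
    ((- 2 / r\<^sup>2) * (flat_exp (k + 2) (1 - ((x - c) \<bullet> (x - c)) / r\<^sup>2)
       - real k * flat_exp (k + 1) (1 - ((x - c) \<bullet> (x - c)) / r\<^sup>2))) *\<^sub>R (x - c)"
proof -
  have "GDERIV (\<lambda>x. 1 - ((x - c) \<bullet> (x - c)) / r\<^sup>2) x :> (- 2 / r\<^sup>2) *\<^sub>R (x - c)"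
    unfolding gderiv_def divide_inverse
    by (auto intro!: derivative_eq_intros simp: inner_commute inner_diff_left algebra_simps)
  from GDERIV_DERIV_compose[OF this DERIV_flat_exp[of k]] show ?thesis
    by (simp add: mult.commute)
qed

lemma bump_algebra_grad:
  fixes f :: "'a::euclidean_space \<Rightarrow> real"
  assumes "bump_algebra c r f"
  shows "\<exists>G. \<forall>x. GDERIV f x :> G x \<and> (\<forall>b. bump_algebra c r (\<lambda>x. G x \<bullet> b))"
  using assms
proof induction
  case (profile k)
  let ?q = "\<lambda>x. 1 - ((x - c) \<bullet> (x - c)) / r\<^sup>2"
  have "bump_algebra c r (\<lambda>x. ((x - c) \<bullet> b) *
      ((- 2 / r\<^sup>2) * (flat_exp (k + 2) (?q x) + (- real k) * flat_exp (k + 1) (?q x))))" for b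
    by (intro bump_algebra.intros)
  then have "bump_algebra c r (\<lambda>x. (((- 2 / r\<^sup>2) * (flat_exp (k + 2) (?q x)
       - real k * flat_exp (k + 1) (?q x))) *\<^sub>R (x - c)) \<bullet> b)" for b
    by (simp add: mult_ac)
  then show ?case using GDERIV_flat_exp_radial[of k c r]
    by (intro exI[of _ "\<lambda>x. ((- 2 / r\<^sup>2) * (flat_exp (k + 2) (?q x)
       - real k * flat_exp (k + 1) (?q x))) *\<^sub>R (x - c)"]) blast
next
  case (coord f b)
  then obtain G where G: "\<And>x. GDERIV f x :> G x" "\<And>b. bump_algebra c r (\<lambda>x. G x \<bullet> b)"
    by blast
  have lin: "GDERIV (\<lambda>x. (x - c) \<bullet> b) x :> b" for x
    unfolding gderiv_def by (auto intro!: derivative_eq_intros)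
  have "bump_algebra c r (\<lambda>x. ((x - c) \<bullet> b) * (G x \<bullet> d) + (b \<bullet> d) * f x)" for d
    by (intro bump_algebra.intros G coord)
  then have "bump_algebra c r (\<lambda>x. (((x - c) \<bullet> b) *\<^sub>R G x + f x *\<^sub>R b) \<bullet> d)" for d
    by (simp add: inner_add_left mult_ac)
  with GDERIV_mult[OF lin G(1)] show ?case
    by (intro exI[of _ "\<lambda>x. ((x - c) \<bullet> b) *\<^sub>R G x + f x *\<^sub>R b"]) blast
next
  case (scale f m)
  then obtain G where G: "\<And>x. GDERIV f x :> G x" "\<And>b. bump_algebra c r (\<lambda>x. G x \<bullet> b)"
    by blast
  have "bump_algebra c r (\<lambda>x. (m *\<^sub>R G x) \<bullet> d)" for d
    using bump_algebra.scale[OF G(2)] by simp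
  moreover have "GDERIV (\<lambda>x. m * f x) x :> m *\<^sub>R G x" for x
    using GDERIV_mult[OF GDERIV_const G(1)] by simp
  ultimately show ?case
    by (intro exI[of _ "\<lambda>x. m *\<^sub>R G x"]) blast
next
  case (add f g)
  then obtain G H where G: "\<And>x. GDERIV f x :> G x" "\<And>b. bump_algebra c r (\<lambda>x. G x \<bullet> b)"
    and H: "\<And>x. GDERIV g x :> H x" "\<And>b. bump_algebra c r (\<lambda>x. H x \<bullet> b)"
    by blast
  have "bump_algebra c r (\<lambda>x. (G x + H x) \<bullet> d)" for d
    using bump_algebra.add[OF G(2) H(2)] by (simp add: inner_add_left)
  with GDERIV_add[OF G(1) H(1)] show ?case
    by (intro exI[of _ "\<lambda>x. G x + H x"]) blast
qed

lemma bump_algebra_smooth: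
  assumes "bump_algebra c r f" shows "smooth f"
proof -
  have "Cn n f" if "bump_algebra c r f" for n and f :: "'a \<Rightarrow> real"
    using that
  proof (induction n arbitrary: f)
    case 0
    then obtain G where "\<And>x. GDERIV f x :> G x" using bump_algebra_grad by blast
    then show ?case
      unfolding gderiv_def
      by (auto intro!: continuous_at_imp_continuous_on has_derivative_continuous)
  next
    case (Suc n)
    then obtain G where G: "\<And>x. GDERIV f x :> G x" "\<And>b. bump_algebra c r (\<lambda>x. G x \<bullet> b)"
      using bump_algebra_grad by blast
    have "f differentiable (at x)" for x
      using G(1) unfolding gderiv_def differentiable_def by blast
    moreover have "grad f x = G x" for x
      using G(1) by (rule grad_eq)
    ultimately show ?case using Suc.IH[OF G(2)] by simp
  qed
  with assms show ?thesis by (auto simp: smooth_def)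
qed

text \<open>
  The value is \<open>exp (- 1 / (1 - \<bar>x - c\<bar>\<^sup>2 / r\<^sup>2))\<close> in the ball of radius \<open>r\<close> about \<open>c\<close>, and
  \<open>0\<close> outside.
\<close>

definition bump :: "'a::euclidean_space \<Rightarrow> real \<Rightarrow> 'a \<Rightarrow> real" where
  "bump c r x = flat_exp 0 (1 - ((x - c) \<bullet> (x - c)) / r\<^sup>2)"

text \<open>
  The radial weight \<open>\<rho>\<close> for which \<open>- \<rho> y *\<^sub>R y\<close> is the gradient of the unit bump at \<open>y\<close>.
\<close>

definition ball_kernel :: "'a::euclidean_space \<Rightarrow> real" where
  "ball_kernel y = 2 * flat_exp 2 (1 - y \<bullet> y)"

lemma bump_eq_0_iff:
  assumes "r > 0" shows "bump c r x = 0 \<longleftrightarrow> x \<notin> ball c r"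
proof -
  have "bump c r x = 0 \<longleftrightarrow> 1 - (norm (x - c))\<^sup>2 / r\<^sup>2 \<le> 0"
    by (simp add: bump_def flat_exp_def power2_norm_eq_inner)
  also have "\<dots> \<longleftrightarrow> r\<^sup>2 \<le> (norm (x - c))\<^sup>2"
    using assms by (simp add: field_simps)
  also have "\<dots> \<longleftrightarrow> r \<le> norm (x - c)"
    using assms abs_le_square_iff[of r "norm (x - c)"] by simp
  finally show ?thesis by (simp add: dist_norm norm_minus_commute not_less)
qed

lemma bump_nonneg: "bump c r x \<ge> 0"
  by (simp add: bump_def flat_exp_nonneg)

lemma continuous_on_flat_exp: "continuous_on S (flat_exp k)"
  by (intro continuous_at_imp_continuous_on ballI DERIV_isCont[OF DERIV_flat_exp])

lemma continuous_on_bump: "continuous_on S (bump c r)"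
proof -
  have "continuous_on S (\<lambda>x. flat_exp 0 (1 - ((x - c) \<bullet> (x - c)) / r\<^sup>2))"
    unfolding divide_inverse
    by (intro continuous_on_compose2[OF continuous_on_flat_exp[of UNIV]] continuous_intros) auto
  then show ?thesis by (simp add: bump_def[abs_def])
qed

lemma continuous_on_ball_kernel: "continuous_on S ball_kernel"
proof -
  have "continuous_on S (\<lambda>x::'a. 2 * flat_exp 2 (1 - (x \<bullet> x)))"
    by (intro continuous_on_compose2[OF continuous_on_flat_exp[of UNIV]] continuous_intros) auto
  then show ?thesis by (simp add: ball_kernel_def[abs_def])
qed

lemma ball_kernel_nonneg: "ball_kernel y \<ge> 0"
  by (simp add: ball_kernel_def flat_exp_nonneg)

lemma grad_bump:
  assumes "r > 0"
  shows "grad (bump c r) x = - (ball_kernel ((1 / r) *\<^sub>R (x - c)) / r\<^sup>2) *\<^sub>R (x - c)"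
proof -
  have "GDERIV (bump c r) x :> - (ball_kernel ((1 / r) *\<^sub>R (x - c)) / r\<^sup>2) *\<^sub>R (x - c)"
    using GDERIV_flat_exp_radial[of 0 c r x] assms
    by (simp add: bump_def[abs_def] ball_kernel_def power2_eq_square numeral_2_eq_2)
  then show ?thesis by (rule grad_eq)
qed

lemma test_fun_bump:
  assumes "r > 0" "cball c r \<subseteq> \<Omega>"
  shows "test_fun \<Omega> (bump c r)"
proof -
  have "{x. bump c r x \<noteq> 0} = ball c r"
    by (auto simp: bump_eq_0_iff[OF assms(1)])
  moreover have "smooth (bump c r)"
    using bump_algebra_smooth[OF bump_algebra.profile[of c r 0]] by (simp add: bump_def[abs_def])
  ultimately show ?thesis
    using assms by (simp add: test_fun_def)
qed

section \<open>A maximum principle for weak solutions\<close>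

lemma set_lebesgue_integral_eq_integral_compact:
  fixes h :: "'a::euclidean_space \<Rightarrow> real"
  assumes "compact Q" "Q \<subseteq> \<Omega>" "continuous_on Q h" "\<And>x. x \<in> \<Omega> - Q \<Longrightarrow> h x = 0"
  shows "(LINT x:\<Omega>|lborel. h x) = integral Q h"
proof -
  have "(LINT x:\<Omega>|lborel. h x) = (LINT x:Q|lborel. h x)"
    unfolding set_lebesgue_integral_def
    by (rule Bochner_Integration.integral_cong) (use assms in \<open>auto simp: indicator_def\<close>)
  also have "\<dots> = integral Q h"
    using borel_integrable_compact[OF assms(1,3)]
    by (intro set_borel_integral_eq_integral(2)) (simp add: set_integrable_def)
  finally show ?thesis .
qed

lemma integral_cbox_pos:
  fixes h :: "'a::euclidean_space \<Rightarrow> real"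
  assumes "continuous_on (cbox a b) h" "\<And>x. x \<in> cbox a b \<Longrightarrow> h x \<ge> 0"
    and "box a b \<noteq> {}" "x \<in> cbox a b" "h x > 0"
  shows "integral (cbox a b) h > 0"
proof -
  have int: "h integrable_on cbox a b"
    using assms(1) by (rule integrable_continuous)
  have "integral (cbox a b) h \<noteq> 0"
  proof
    assume "integral (cbox a b) h = 0"
    then have "(h has_integral 0) (cbox a b)"
      using int by (simp add: has_integral_iff)
    from has_integral_0_cbox_imp_0[OF assms(1) _ this assms(3,4)] assms(2,5)
    show False using box_subset_cbox by fastforce
  qed
  moreover have "integral (cbox a b) h \<ge> 0"
    using int assms(2) by (rule integral_nonneg)
  ultimately show ?thesis by simp
qed

text \<open>
  A maximum principle for \<open>- \<Delta>W = R\<close> in the weak sense. If \<open>R x0 < 0\<close>, then \<open>R < 0\<close> near \<open>x0\<close>.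
  Let \<open>m r\<close> be the mean of \<open>W\<close> over the ball of radius \<open>r\<close> about \<open>x0\<close>, with weight \<open>ball_kernel\<close> and
  not normalised. As \<open>ball_kernel y *\<^sub>R y\<close> is minus the gradient of a bump, the integral that
  gives \<open>m' r\<close> is, after the substitution \<open>x = x0 + r *\<^sub>R y\<close>, a negative multiple of the left-hand
  side of the weak equation tested with \<open>bump x0 r\<close>, hence of the negative number
  \<open>\<integral> R * bump x0 r\<close>. So \<open>m\<close> strictly increases, whereas \<open>W \<le> W x0\<close> forces \<open>m r \<le> m 0\<close>.
\<close>

lemma weak_maximum_imp_source_nonneg:
  fixes \<Omega> :: "'a::euclidean_space set" and W R :: "'a \<Rightarrow> real"
  assumes "open \<Omega>" "x0 \<in> \<Omega>"
    and W: "\<And>x. x \<in> \<Omega> \<Longrightarrow> GDERIV W x :> G x"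
    and G: "continuous_on \<Omega> G" and R: "continuous_on \<Omega> R"
    and weak: "\<And>\<phi>. test_fun \<Omega> \<phi> \<Longrightarrow>
      (LINT x:\<Omega>|lborel. G x \<bullet> grad \<phi> x) = (LINT x:\<Omega>|lborel. R x * \<phi> x)"
    and max: "\<And>x. x \<in> \<Omega> \<Longrightarrow> W x \<le> W x0"
  shows "R x0 \<ge> 0"
proof (rule ccontr)
  assume "\<not> R x0 \<ge> 0"
  then have "x0 \<in> R -` {..<0} \<inter> \<Omega>"
    using \<open>x0 \<in> \<Omega>\<close> by simp
  moreover have "open (R -` {..<0} \<inter> \<Omega>)"
    using R \<open>open \<Omega>\<close> by (simp add: continuous_on_open_vimage)
  ultimately obtain e where e: "e > 0" "cball x0 e \<subseteq> R -` {..<0} \<inter> \<Omega>"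
    unfolding open_contains_cball by blast
  \<comment> \<open>A box around the unit ball: differentiation under the integral is available over boxes, and
    the weight vanishes on the rest of the box.\<close>
  define B where "B = cbox (- One) (One :: 'a)"
  \<comment> \<open>Points of the box have norm at most the dimension, so the scaled boxes stay within distance e of x0.\<close>
  define d where "d = e / DIM('a)"
  have d: "d > 0" "d \<le> e"
    using e DIM_positive[where 'a='a] by (auto simp: d_def field_simps intro: Suc_leI)
  have norm_B: "norm y \<le> DIM('a)" if "y \<in> B" for y
  proof -
    have "norm y \<le> (\<Sum>b\<in>Basis. \<bar>y \<bullet> b\<bar>)" by (rule norm_le_l1)
    also have "\<dots> \<le> (\<Sum>b\<in>(Basis::'a set). 1)"
      using that by (intro sum_mono) (auto simp: B_def mem_box abs_le_iff)
    finally show ?thesis by simp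
  qed
  have near: "x0 + r *\<^sub>R y \<in> cball x0 e" if "r \<in> {0..d}" "y \<in> B" for r y
  proof -
    have "r * norm y \<le> d * DIM('a)"
      using that norm_B d by (intro mult_mono) auto
    then show ?thesis using that by (simp add: dist_norm d_def)
  qed
  then have inside: "x0 + r *\<^sub>R y \<in> \<Omega>" if "r \<in> {0..d}" "y \<in> B" for r y
    using that e by blast
  have W_cont: "continuous_on \<Omega> W"
    using W by (auto intro!: continuous_at_imp_continuous_on has_derivative_continuous
      simp: gderiv_def)
  define m where "m r = integral B (\<lambda>y. W (x0 + r *\<^sub>R y) * ball_kernel y)" for r
  define m' where "m' r = integral B (\<lambda>y. (G (x0 + r *\<^sub>R y) \<bullet> y) * ball_kernel y)" for r
  have cont_slice: "continuous_on B (\<lambda>y. W (x0 + r *\<^sub>R y) * ball_kernel y)"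
    if "r \<in> {0..d}" for r
    using inside[OF that]
    by (intro continuous_intros continuous_on_ball_kernel continuous_on_compose2[OF W_cont]) auto
  have cont_slice': "continuous_on B (\<lambda>y. (G (x0 + r *\<^sub>R y) \<bullet> y) * ball_kernel y)"
    if "r \<in> {0..d}" for r
    using inside[OF that]
    by (intro continuous_intros continuous_on_ball_kernel continuous_on_compose2[OF G]) auto
  have m_deriv: "(m has_field_derivative m' r) (at r within {0..d})" if r: "r \<in> {0..d}" for r
    unfolding m_def m'_def B_def
  proof (rule leibniz_rule_field_derivative[where U = "{0..d}"])
    fix s y assume s: "s \<in> {0..d}" "y \<in> cbox (- One) (One :: 'a)"
    have "((\<lambda>s. x0 + s *\<^sub>R y) has_derivative (\<lambda>h. h *\<^sub>R y)) (at s within {0..d})"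
      by (auto intro!: derivative_eq_intros)
    moreover have "(W has_derivative (\<lambda>h. h \<bullet> G (x0 + s *\<^sub>R y))) (at (x0 + s *\<^sub>R y))"
      using W[OF inside[of s y]] s by (simp add: gderiv_def B_def)
    ultimately have "((\<lambda>s. W (x0 + s *\<^sub>R y)) has_derivative
        (\<lambda>h. (h *\<^sub>R y) \<bullet> G (x0 + s *\<^sub>R y))) (at s within {0..d})"
      by (rule has_derivative_compose)
    then have "((\<lambda>s. W (x0 + s *\<^sub>R y)) has_field_derivative (G (x0 + s *\<^sub>R y) \<bullet> y))
        (at s within {0..d})"
      by (simp add: has_field_derivative_def inner_commute mult_commute_abs)
    then show "((\<lambda>s. W (x0 + s *\<^sub>R y) * ball_kernel y) has_field_derivative
        (G (x0 + s *\<^sub>R y) \<bullet> y) * ball_kernel y) (at s within {0..d})"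
      by (rule DERIV_cmult_right)
  next
    fix s assume "s \<in> {0..d}"
    then show "(\<lambda>y. W (x0 + s *\<^sub>R y) * ball_kernel y) integrable_on cbox (- One) One"
      using cont_slice by (intro integrable_continuous) (simp add: B_def)
  next
    have "continuous_on ({0..d} \<times> B)
      (\<lambda>z. (G (x0 + fst z *\<^sub>R snd z) \<bullet> snd z) * ball_kernel (snd z))"
      using inside
      by (intro continuous_intros continuous_on_compose2[OF G]
          continuous_on_compose2[OF continuous_on_ball_kernel[of UNIV]]) auto
    then show "continuous_on ({0..d} \<times> cbox (- One) (One :: 'a))
      (\<lambda>(s, y). (G (x0 + s *\<^sub>R y) \<bullet> y) * ball_kernel y)"
      by (simp add: B_def case_prod_unfold)
  qed (use r in auto)
  have m'_pos: "m' r > 0" if r: "0 < r" "r \<le> d" for r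
  proof -
    \<comment> \<open>The box after the substitution; it carries the test function.\<close>
    define Q where "Q = (\<lambda>y. r *\<^sub>R y + x0) ` B"
    have Q_cbox: "Q = cbox (r *\<^sub>R (- One) + x0) (r *\<^sub>R One + x0)"
    proof -
      have "0 \<in> cbox (- One) (One :: 'a)" by (simp add: mem_box)
      then show ?thesis
        using r unfolding Q_def B_def image_affinity_cbox by auto
    qed
    have "compact Q" by (simp add: Q_cbox)
    moreover have "Q \<subseteq> cball x0 e"
      using near[of r] r unfolding Q_def by (simp add: image_subset_iff add.commute)
    ultimately have Q: "compact Q" "Q \<subseteq> cball x0 e" .
    have ball_Q: "ball x0 r \<subseteq> Q"
    proof
      fix x assume "x \<in> ball x0 r"
      then have "norm (x - x0) \<le> r" by (simp add: dist_norm norm_minus_commute)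
      then have "\<bar>(x - x0) \<bullet> b\<bar> \<le> r" if "b \<in> Basis" for b
        using Basis_le_norm[OF that, of "x - x0"] by linarith
      then show "x \<in> Q"
        by (auto simp: Q_cbox mem_box inner_diff_left inner_add_left abs_le_iff algebra_simps)
    qed
    let ?\<phi> = "bump x0 r"
    have outside: "?\<phi> x = 0 \<and> grad ?\<phi> x = 0" if "x \<notin> Q" for x
    proof -
      have "x \<notin> ball x0 r" using that ball_Q by blast
      then have "r \<le> norm (x - x0)" by (simp add: dist_norm norm_minus_commute)
      then have "1 \<le> norm ((1 / r) *\<^sub>R (x - x0))" using r by simp
      then have "1 \<le> ((1 / r) *\<^sub>R (x - x0)) \<bullet> ((1 / r) *\<^sub>R (x - x0))"
        unfolding power2_norm_eq_inner[symmetric] by (rule one_le_power)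
      then have "ball_kernel ((1 / r) *\<^sub>R (x - x0)) = 0"
        unfolding ball_kernel_def flat_exp_def by simp
      then show ?thesis
        using \<open>x \<notin> ball x0 r\<close> r grad_bump[of r x0 x] bump_eq_0_iff[of r x0 x] by simp
    qed
    have grad_scaled: "grad ?\<phi> x = (- (1 / r)) *\<^sub>R
        (ball_kernel ((1 / r) *\<^sub>R (x - x0)) *\<^sub>R ((1 / r) *\<^sub>R (x - x0)))" for x
      using r grad_bump[of r x0 x] by (simp add: power2_eq_square)
    have cont_Q: "continuous_on Q (\<lambda>x. G x \<bullet> grad ?\<phi> x)" "continuous_on Q (\<lambda>x. R x * ?\<phi> x)"
      unfolding grad_scaled using Q e
      by (intro continuous_intros continuous_on_subset[OF G] continuous_on_subset[OF R]
          continuous_on_bump continuous_on_compose2[OF continuous_on_ball_kernel[of UNIV]]; auto)+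
    have "test_fun \<Omega> ?\<phi>"
      using r d e by (intro test_fun_bump) auto
    then have "(LINT x:\<Omega>|lborel. G x \<bullet> grad ?\<phi> x) = (LINT x:\<Omega>|lborel. R x * ?\<phi> x)"
      by (rule weak)
    then have eq: "integral Q (\<lambda>x. G x \<bullet> grad ?\<phi> x) = integral Q (\<lambda>x. R x * ?\<phi> x)"
      using set_lebesgue_integral_eq_integral_compact[OF Q(1) _ cont_Q(1), of \<Omega>]
        set_lebesgue_integral_eq_integral_compact[OF Q(1) _ cont_Q(2), of \<Omega>] outside Q e
      by auto
    have "integral Q (\<lambda>x. - (R x * ?\<phi> x)) > 0"
      unfolding Q_cbox
    proof (rule integral_cbox_pos[where x = x0])
      show "continuous_on (cbox (r *\<^sub>R (- One) + x0) (r *\<^sub>R One + x0)) (\<lambda>x. - (R x * ?\<phi> x))"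
        using cont_Q(2) unfolding Q_cbox by (rule continuous_on_minus)
      show "0 \<le> - (R x * ?\<phi> x)" if "x \<in> cbox (r *\<^sub>R (- One) + x0) (r *\<^sub>R One + x0)" for x
      proof -
        have "R x < 0" using that Q(2) e(2) unfolding Q_cbox by auto
        then show ?thesis using bump_nonneg[of x0 r x] by (simp add: mult_nonpos_nonneg)
      qed
      show "box (r *\<^sub>R (- One) + x0) (r *\<^sub>R One + x0) \<noteq> {}"
        using r by (simp add: box_ne_empty algebra_simps)
      show "x0 \<in> cbox (r *\<^sub>R (- One) + x0) (r *\<^sub>R One + x0)"
        using r by (simp add: mem_box algebra_simps)
      have "?\<phi> x0 > 0"
        using bump_eq_0_iff[OF r(1), of x0 x0] bump_nonneg[of x0 r x0] r by simp
      moreover have "R x0 < 0" using \<open>x0 \<in> R -` {..<0} \<inter> \<Omega>\<close> by simp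
      ultimately show "0 < - (R x0 * ?\<phi> x0)" by (simp add: mult_neg_pos)
    qed
    then have neg: "integral Q (\<lambda>x. G x \<bullet> grad ?\<phi> x) < 0"
      using eq by simp
    have "((\<lambda>y. (G (x0 + r *\<^sub>R y) \<bullet> y) * ball_kernel y) has_integral m' r) (cbox (- One) One)"
      using cont_slice'[of r] r unfolding m'_def B_def
      by (intro integrable_integral integrable_continuous) simp
    from has_integral_affinity[OF this, of "1 / r" "- ((1 / r) *\<^sub>R x0)"] r
    have "((\<lambda>x. (G (x0 + r *\<^sub>R ((1 / r) *\<^sub>R x - (1 / r) *\<^sub>R x0)) \<bullet> ((1 / r) *\<^sub>R x - (1 / r) *\<^sub>R x0))
          * ball_kernel ((1 / r) *\<^sub>R x - (1 / r) *\<^sub>R x0)) has_integral r ^ DIM('a) * m' r) Q"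
      by (simp add: Q_def B_def power_one_over)
    moreover have "(G (x0 + r *\<^sub>R ((1 / r) *\<^sub>R x - (1 / r) *\<^sub>R x0)) \<bullet> ((1 / r) *\<^sub>R x - (1 / r) *\<^sub>R x0))
          * ball_kernel ((1 / r) *\<^sub>R x - (1 / r) *\<^sub>R x0) = - r * (G x \<bullet> grad ?\<phi> x)" for x
    proof -
      have "x0 + r *\<^sub>R ((1 / r) *\<^sub>R x - (1 / r) *\<^sub>R x0) = x"
        using r by (simp add: scaleR_diff_right)
      moreover have "(1 / r) *\<^sub>R x - (1 / r) *\<^sub>R x0 = (1 / r) *\<^sub>R (x - x0)"
        by (simp add: scaleR_diff_right)
      ultimately show ?thesis
        unfolding grad_scaled using r by simp
    qed
    ultimately have "((\<lambda>x. - r * (G x \<bullet> grad ?\<phi> x)) has_integral r ^ DIM('a) * m' r) Q"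
      by (simp only:)
    then have "integral Q (\<lambda>x. - r * (G x \<bullet> grad ?\<phi> x)) = r ^ DIM('a) * m' r"
      by (rule integral_unique)
    then have "r ^ DIM('a) * m' r = - r * integral Q (\<lambda>x. G x \<bullet> grad ?\<phi> x)"
      by (simp only: integral_mult_right)
    also have "\<dots> > 0" using neg r by (simp add: mult_pos_neg)
    finally show ?thesis using r by (simp add: zero_less_mult_iff)
  qed
  obtain \<xi> where \<xi>: "\<xi> \<in> {0<..<d}" "m d - m 0 = m' \<xi> * (d - 0)"
    using mvt_simple[OF d(1), of m "\<lambda>r h. m' r * h"] m_deriv
    by (auto simp: has_field_derivative_def)
  then have "m' \<xi> * d > 0" using m'_pos[of \<xi>] d by simp
  then have "m d > m 0" using \<xi> by simp
  moreover have "m d \<le> m 0"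
    unfolding m_def
  proof (rule integral_le)
    show "(\<lambda>y. W (x0 + d *\<^sub>R y) * ball_kernel y) integrable_on B"
      "(\<lambda>y. W (x0 + 0 *\<^sub>R y) * ball_kernel y) integrable_on B"
      using cont_slice[of d] cont_slice[of 0] d unfolding B_def
      by (auto intro!: integrable_continuous)
    show "W (x0 + d *\<^sub>R y) * ball_kernel y \<le> W (x0 + 0 *\<^sub>R y) * ball_kernel y" if "y \<in> B" for y
      using max[OF inside[of d y]] that d ball_kernel_nonneg[of y] by (simp add: mult_right_mono)
  qed
  ultimately show False by simp
qed

section \<open>Uniqueness for the model equation\<close>

lemma set_integrable_compact_support:
  fixes h :: "'a::euclidean_space \<Rightarrow> real"
  assumes "compact K" "K \<subseteq> \<Omega>" "continuous_on K h" "\<And>x. x \<in> \<Omega> - K \<Longrightarrow> h x = 0"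
  shows "set_integrable lborel \<Omega> h"
proof -
  have "integrable lborel (\<lambda>x. indicator K x *\<^sub>R h x)"
    using assms by (intro borel_integrable_compact)
  also have "(\<lambda>x. indicator K x *\<^sub>R h x) = (\<lambda>x. indicator \<Omega> x *\<^sub>R h x)"
    using assms by (auto simp: indicator_def fun_eq_iff)
  finally show ?thesis by (simp add: set_integrable_def)
qed

lemma test_funD:
  fixes \<phi> :: "'a::euclidean_space \<Rightarrow> real"
  assumes "test_fun \<Omega> \<phi>"
  obtains K where "compact K" "K \<subseteq> \<Omega>" "continuous_on UNIV \<phi>" "continuous_on UNIV (grad \<phi>)"
    "\<And>x. x \<notin> K \<Longrightarrow> \<phi> x = 0" "\<And>x. x \<notin> K \<Longrightarrow> grad \<phi> x = 0"
proof
  let ?K = "closure {x. \<phi> x \<noteq> 0}"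
  show "compact ?K" "?K \<subseteq> \<Omega>"
    using assms by (auto simp: test_fun_def)
  have C: "Cn n \<phi>" for n
    using assms by (simp add: test_fun_def smooth_def)
  show "continuous_on UNIV \<phi>" using C[of 0] by simp
  have "continuous_on UNIV (\<lambda>x. grad \<phi> x \<bullet> b)" if "b \<in> Basis" for b
    using C[of "Suc 0"] that by simp
  then show "continuous_on UNIV (grad \<phi>)"
    by (rule continuous_on_componentwise[THEN iffD2, rule_format])
  show *: "\<phi> x = 0" if "x \<notin> ?K" for x
    using that closure_subset[of "{x. \<phi> x \<noteq> 0}"] by auto
  show "grad \<phi> x = 0" if "x \<notin> ?K" for x
  proof (rule grad_eq)
    have "((\<lambda>_. 0::real) has_derivative (\<lambda>h. h \<bullet> 0)) (at x)" by simp
    then have "(\<phi> has_derivative (\<lambda>h. h \<bullet> 0)) (at x)"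
    proof (rule has_derivative_transform_within_open)
      show "open (- ?K)" by (simp add: open_Compl)
      show "x \<in> - ?K" unfolding Compl_iff by (rule that)
      show "0 = \<phi> y" if "y \<in> - ?K" for y
        using *[OF ComplD[OF that]] by (rule sym)
    qed
    then show "GDERIV \<phi> x :> 0" by (simp add: gderiv_def)
  qed
qed

lemma C10_nonneg_closure:
  assumes "u \<in> C10 \<Omega>" "\<And>x. x \<in> \<Omega> \<Longrightarrow> u x > 0" shows "u x \<ge> 0"
  using assms by (cases "x \<in> \<Omega>") (auto simp: C10_def less_imp_le)

text \<open>
  The tangent at \<open>S0 powr r\<close> of the concave function \<open>s \<mapsto> (M + s powr (1 / r)) powr r\<close>, evaluated at
  \<open>s = S powr r\<close>. It follows from convexity of \<open>x powr r\<close>, on writing \<open>M + S\<close> as the mean of \<open>A\<close> and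
  \<open>A * S / S0\<close> with weights \<open>M / A\<close> and \<open>S0 / A\<close>, where \<open>A = M + S0\<close>.
\<close>

lemma powr_add_le_tangent:
  fixes M S S0 r :: real
  assumes "r \<ge> 1" "M > 0" "S > 0" "S0 > 0"
  shows "(M + S) powr r \<le> M * (M + S0) powr (r - 1) + ((M + S0) / S0) powr (r - 1) * S powr r"
proof -
  define A where "A = M + S0"
  have A: "A > 0" "S0 \<le> A" using assms by (auto simp: A_def)
  have sum1: "M / A + S0 / A = 1"
    using A by (simp add: A_def flip: add_divide_distrib)
  have "(M / A) *\<^sub>R A + (S0 / A) *\<^sub>R (A * S / S0) = M + S"
    using A assms by simp
  moreover have "((1 - S0 / A) *\<^sub>R A + (S0 / A) *\<^sub>R (A * S / S0)) powr r
      \<le> (1 - S0 / A) * A powr r + (S0 / A) * (A * S / S0) powr r"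
    using A assms
    by (intro convex_onD[OF powr_convex[OF \<open>r \<ge> 1\<close>]]) auto
  moreover have "1 - S0 / A = M / A"
    using sum1 by simp
  ultimately have "(M + S) powr r \<le> (M / A) * A powr r + (S0 / A) * (A * S / S0) powr r"
    by (simp only:)
  also have "(M / A) * A powr r = M * A powr (r - 1)"
    using A by (simp add: powr_diff)
  also have "(S0 / A) * (A * S / S0) powr r = (A / S0) powr (r - 1) * S powr r"
    using A assms by (simp add: powr_diff powr_mult powr_divide field_simps)
  finally show ?thesis by (simp add: A_def)
qed

text \<open>
  Maximising \<open>u - w\<close> directly works only when \<open>s powr (p - 1)\<close> is decreasing, and maximising
  \<open>u / w\<close> requires control of the quotient at the boundary. The difference \<open>u powr q - w powr q\<close> with
  small \<open>q > 0\<close> lies between the two: it vanishes on the boundary, and \<open>q < 2 - p\<close> makes the source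
  term of the linearised equation negative at the maximum.
\<close>

lemma pos_weak_solution_le:
  fixes \<Omega> :: "'a::euclidean_space set"
  assumes "open \<Omega>" "bounded \<Omega>" "p < 2"
    and u: "pos_weak_solution \<Omega> 1 (\<lambda>s. s powr (p - 1)) u"
    and w: "pos_weak_solution \<Omega> 1 (\<lambda>s. s powr (p - 1)) w"
    and "x1 \<in> \<Omega>"
  shows "u x1 \<le> w x1"
proof (rule ccontr)
  assume "\<not> u x1 \<le> w x1"
  have uC: "u \<in> C10 \<Omega>" and wC: "w \<in> C10 \<Omega>"
    and u_pos: "\<And>x. x \<in> \<Omega> \<Longrightarrow> u x > 0" and w_pos: "\<And>x. x \<in> \<Omega> \<Longrightarrow> w x > 0"
    using u w by (auto simp: pos_weak_solution_def)
  have u_cont: "continuous_on (closure \<Omega>) u" and w_cont: "continuous_on (closure \<Omega>) w"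
    using uC wC by (auto simp: C10_def)
  note u_ge = C10_nonneg_closure[OF uC u_pos] and w_ge = C10_nonneg_closure[OF wC w_pos]
  \<comment> \<open>Any q with 0 < q < 1 and q < 2 - p would do.\<close>
  define q where "q = min 1 (2 - p) / 2"
  have q: "0 < q" "q < 1" "q < 2 - p"
    using \<open>p < 2\<close> by (auto simp: q_def)
  define D where "D x = u x powr q - w x powr q" for x
  have "continuous_on (closure \<Omega>) D"
    unfolding D_def using u_cont w_cont u_ge w_ge q
    by (intro continuous_intros continuous_on_powr') auto
  moreover have "compact (closure \<Omega>)" "closure \<Omega> \<noteq> {}"
    using \<open>bounded \<Omega>\<close> \<open>x1 \<in> \<Omega>\<close> by auto
  ultimately obtain x0 where x0: "x0 \<in> closure \<Omega>" and max: "\<And>x. x \<in> closure \<Omega> \<Longrightarrow> D x \<le> D x0"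
    using continuous_attains_sup[of "closure \<Omega>" D] by blast
  have "w x1 powr q < u x1 powr q"
    using \<open>\<not> u x1 \<le> w x1\<close> q w_ge[of x1] by (intro powr_less_mono2) auto
  then have "D x1 > 0" by (simp add: D_def)
  moreover have "x1 \<in> closure \<Omega>" using \<open>x1 \<in> \<Omega>\<close> closure_subset by blast
  ultimately have M: "D x0 > 0" using max[of x1] by linarith
  have x0: "x0 \<in> \<Omega>"
  proof (rule ccontr)
    assume "x0 \<notin> \<Omega>"
    then have "u x0 = 0" "w x0 = 0" using uC wC by (auto simp: C10_def)
    then show False using M q by (simp add: D_def)
  qed
  define A0 where "A0 = u x0 powr q"
  define S0 where "S0 = w x0 powr q"
  define \<kappa> where "\<kappa> = (A0 / S0) powr (1 / q - 1)"
  have pos: "A0 > 0" "S0 > 0" and D0: "D x0 + S0 = A0"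
    using u_pos[OF x0] w_pos[OF x0] by (auto simp: A0_def S0_def D_def)
  have inv: "(s powr q) powr (1 / q) = s" if "s > 0" for s :: real
    using that q by (simp add: powr_powr)
  \<comment> \<open>The concave function of the tangent inequality is linearised at w x0.\<close>
  have le: "u x - \<kappa> * w x \<le> D x0 * A0 powr (1 / q - 1)" if "x \<in> \<Omega>" for x
  proof -
    have "u x powr q \<le> D x0 + w x powr q"
      using max[of x] that closure_subset[of \<Omega>] by (auto simp: D_def)
    then have "(u x powr q) powr (1 / q) \<le> (D x0 + w x powr q) powr (1 / q)"
      using q by (intro powr_mono2) auto
    also have "\<dots> \<le> D x0 * (D x0 + S0) powr (1 / q - 1)
        + ((D x0 + S0) / S0) powr (1 / q - 1) * (w x powr q) powr (1 / q)"
      using q M pos w_pos[OF that] by (intro powr_add_le_tangent) auto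
    finally show ?thesis
      using inv[OF u_pos[OF that]] inv[OF w_pos[OF that]] D0 by (simp add: \<kappa>_def)
  qed
  have eq: "u x0 - \<kappa> * w x0 = D x0 * A0 powr (1 / q - 1)"
  proof -
    have "u x0 = A0 powr (1 / q)" "w x0 = S0 powr (1 / q)"
      using inv u_pos[OF x0] w_pos[OF x0] by (simp_all add: A0_def S0_def)
    moreover have "D x0 = A0 - S0" using D0 by simp
    moreover have "A0 powr (1 / q) - \<kappa> * S0 powr (1 / q) = (A0 - S0) * A0 powr (1 / q - 1)"
      using pos by (simp add: \<kappa>_def powr_divide powr_diff field_simps)
    ultimately show ?thesis by (simp only:)
  qed
  define R where "R x = u x powr (p - 1) - \<kappa> * w x powr (p - 1)" for x
  have "R x0 < 0"
  proof -
    have "\<kappa> = (u x0 / w x0) powr (1 - q)"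
      using q u_pos[OF x0] w_pos[OF x0]
      by (simp add: \<kappa>_def A0_def S0_def powr_powr right_diff_distrib flip: powr_divide)
    then have \<kappa>: "\<kappa> = u x0 powr (1 - q) / w x0 powr (1 - q)"
      by (simp add: powr_divide)
    have "w x0 < u x0"
    proof (rule ccontr)
      assume "\<not> w x0 < u x0"
      then have "u x0 powr q \<le> w x0 powr q" using q u_ge by (intro powr_mono2) auto
      then show False using M by (simp add: D_def)
    qed
    \<comment> \<open>The exponent p - 2 + q is negative.\<close>
    then have "u x0 powr (p - 2 + q) < w x0 powr (p - 2 + q)"
      using q w_pos[OF x0] by (intro powr_less_mono2_neg) auto
    then have "u x0 powr (1 - q) * u x0 powr (p - 2 + q)
        < u x0 powr (1 - q) * w x0 powr (p - 2 + q)"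
      using u_pos[OF x0] by (intro mult_strict_left_mono) auto
    also have "u x0 powr (1 - q) * u x0 powr (p - 2 + q) = u x0 powr (p - 1)"
      by (simp flip: powr_add)
    also have "u x0 powr (1 - q) * w x0 powr (p - 2 + q) = \<kappa> * w x0 powr (p - 1)"
    proof -
      have "w x0 powr (p - 2 + q) = w x0 powr ((p - 1) - (1 - q))" by (simp add: algebra_simps)
      also have "\<dots> = w x0 powr (p - 1) / w x0 powr (1 - q)" by (rule powr_diff)
      finally show ?thesis by (simp add: \<kappa>)
    qed
    finally show ?thesis by (simp add: R_def)
  qed
  obtain Gu where Gu: "continuous_on (closure \<Omega>) Gu" "\<And>x. x \<in> \<Omega> \<Longrightarrow> GDERIV u x :> Gu x"
    using uC by (auto simp: C10_def)
  obtain Gw where Gw: "continuous_on (closure \<Omega>) Gw" "\<And>x. x \<in> \<Omega> \<Longrightarrow> GDERIV w x :> Gw x"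
    using wC by (auto simp: C10_def)
  have sub: "\<Omega> \<subseteq> closure \<Omega>" by (rule closure_subset)
  have "R x0 \<ge> 0"
  proof (rule weak_maximum_imp_source_nonneg[OF \<open>open \<Omega>\<close> x0])
    show "GDERIV (\<lambda>x. u x - \<kappa> * w x) x :> Gu x - \<kappa> *\<^sub>R Gw x" if "x \<in> \<Omega>" for x
      using GDERIV_diff[OF Gu(2)[OF that] GDERIV_mult[OF GDERIV_const[of \<kappa>] Gw(2)[OF that]]]
      by simp
    show "continuous_on \<Omega> (\<lambda>x. Gu x - \<kappa> *\<^sub>R Gw x)"
      using continuous_on_subset[OF Gu(1) sub] continuous_on_subset[OF Gw(1) sub]
      by (intro continuous_intros)
    have powr_cont: "continuous_on \<Omega> (\<lambda>x. u x powr (p - 1))" "continuous_on \<Omega> (\<lambda>x. w x powr (p - 1))"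
      using continuous_on_subset[OF u_cont sub] continuous_on_subset[OF w_cont sub] u_pos w_pos
      by (intro continuous_on_powr continuous_on_const; force)+
    then show "continuous_on \<Omega> R"
      unfolding R_def by (intro continuous_on_diff continuous_on_mult_left)
    show "(LINT x:\<Omega>|lborel. (Gu x - \<kappa> *\<^sub>R Gw x) \<bullet> grad \<phi> x) = (LINT x:\<Omega>|lborel. R x * \<phi> x)"
      if \<phi>: "test_fun \<Omega> \<phi>" for \<phi>
    proof -
      have \<Omega>_meas: "\<Omega> \<in> sets lborel" using \<open>open \<Omega>\<close> by simp
      have weak: "(LINT x:\<Omega>|lborel. G x \<bullet> grad \<phi> x) = (LINT x:\<Omega>|lborel. z x powr (p - 1) * \<phi> x)"
        if "pos_weak_solution \<Omega> 1 (\<lambda>s. s powr (p - 1)) z" "\<And>x. x \<in> \<Omega> \<Longrightarrow> GDERIV z x :> G x" for z G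
      proof -
        have "(LINT x:\<Omega>|lborel. G x \<bullet> grad \<phi> x) = (LINT x:\<Omega>|lborel. grad z x \<bullet> grad \<phi> x)"
          using that(2) \<Omega>_meas by (intro set_lebesgue_integral_cong) (auto simp: grad_eq[OF that(2)])
        then show ?thesis using that(1) \<phi> by (simp add: pos_weak_solution_def)
      qed
      obtain K where K: "compact K" "K \<subseteq> \<Omega>" "continuous_on UNIV \<phi>" "continuous_on UNIV (grad \<phi>)"
        "\<And>x. x \<notin> K \<Longrightarrow> \<phi> x = 0" "\<And>x. x \<notin> K \<Longrightarrow> grad \<phi> x = 0"
        using test_funD[OF \<phi>] by blast
      have int_grad: "set_integrable lborel \<Omega> (\<lambda>x. G x \<bullet> grad \<phi> x)"
        if "continuous_on (closure \<Omega>) G" for G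
      proof (rule set_integrable_compact_support[OF K(1,2)])
        have "K \<subseteq> closure \<Omega>" using K(2) sub by (rule order_trans)
        then show "continuous_on K (\<lambda>x. G x \<bullet> grad \<phi> x)"
          by (intro continuous_on_inner continuous_on_subset[OF that]
              continuous_on_subset[OF K(4)]) auto
      qed (simp add: K)
      have int_powr: "set_integrable lborel \<Omega> (\<lambda>x. z x * \<phi> x)" if "continuous_on \<Omega> z" for z
      proof (rule set_integrable_compact_support[OF K(1,2)])
        show "continuous_on K (\<lambda>x. z x * \<phi> x)"
          using K(2) by (intro continuous_on_mult continuous_on_subset[OF that]
              continuous_on_subset[OF K(3)]) auto
      qed (simp add: K)
      have "(LINT x:\<Omega>|lborel. (Gu x - \<kappa> *\<^sub>R Gw x) \<bullet> grad \<phi> x)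
          = (LINT x:\<Omega>|lborel. Gu x \<bullet> grad \<phi> x - \<kappa> * (Gw x \<bullet> grad \<phi> x))"
        by (simp add: inner_diff_left)
      also have "\<dots> = (LINT x:\<Omega>|lborel. Gu x \<bullet> grad \<phi> x) - \<kappa> * (LINT x:\<Omega>|lborel. Gw x \<bullet> grad \<phi> x)"
        using int_grad[OF Gu(1)] int_grad[OF Gw(1)] by (simp add: set_integral_diff)
      also have "\<dots> = (LINT x:\<Omega>|lborel. u x powr (p - 1) * \<phi> x)
          - \<kappa> * (LINT x:\<Omega>|lborel. w x powr (p - 1) * \<phi> x)"
        using weak[OF u Gu(2)] weak[OF w Gw(2)] by simp
      also have "\<dots> = (LINT x:\<Omega>|lborel. u x powr (p - 1) * \<phi> x - \<kappa> * (w x powr (p - 1) * \<phi> x))"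
        using int_powr[OF powr_cont(1)] int_powr[OF powr_cont(2)] by (simp add: set_integral_diff)
      also have "\<dots> = (LINT x:\<Omega>|lborel. R x * \<phi> x)"
        by (simp add: R_def algebra_simps)
      finally show ?thesis .
    qed
    show "u x - \<kappa> * w x \<le> u x0 - \<kappa> * w x0" if "x \<in> \<Omega>" for x
      using le[OF that] eq by simp
  qed
  with \<open>R x0 < 0\<close> show False by simp
qed

lemma pos_weak_solution_unique:
  fixes \<Omega> :: "'a::euclidean_space set"
  assumes "open \<Omega>" "bounded \<Omega>" "p < 2"
    and u: "pos_weak_solution \<Omega> 1 (\<lambda>s. s powr (p - 1)) u"
    and w: "pos_weak_solution \<Omega> 1 (\<lambda>s. s powr (p - 1)) w"
  shows "u = w"
proof
  fix x
  show "u x = w x"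
  proof (cases "x \<in> \<Omega>")
    case True
    then show ?thesis
      by (intro order_antisym pos_weak_solution_le[OF assms(1-3) u w]
          pos_weak_solution_le[OF assms(1-3) w u])
  next
    case False
    then show ?thesis using u w by (simp add: pos_weak_solution_def C10_def)
  qed
qed

section \<open>Reduction to a scalar equation\<close>

lemma C10_scale:
  assumes "u \<in> C10 \<Omega>" shows "(\<lambda>x. s * u x) \<in> C10 \<Omega>"
proof -
  obtain G where G: "continuous_on (closure \<Omega>) G" "\<And>x. x \<in> \<Omega> \<Longrightarrow> GDERIV u x :> G x"
    using assms by (auto simp: C10_def)
  have "continuous_on (closure \<Omega>) (\<lambda>x. s *\<^sub>R G x)"
    using G(1) by (intro continuous_intros)
  moreover have "GDERIV (\<lambda>x. s * u x) x :> s *\<^sub>R G x" if "x \<in> \<Omega>" for x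
    using GDERIV_mult[OF GDERIV_const[of s] G(2)[OF that]] by simp
  moreover have "continuous_on (closure \<Omega>) (\<lambda>x. s * u x)"
    using assms by (intro continuous_on_mult_left) (simp add: C10_def)
  ultimately show ?thesis
    using assms unfolding C10_def by auto
qed

lemma grad_scale:
  assumes "u \<in> C10 \<Omega>" "x \<in> \<Omega>"
  shows "grad (\<lambda>x. s * u x) x = s *\<^sub>R grad u x"
proof -
  obtain G where G: "GDERIV u x :> G"
    using assms by (auto simp: C10_def)
  show ?thesis
    using grad_eq[OF GDERIV_mult[OF GDERIV_const[of s] G]] grad_eq[OF G] by simp
qed

lemma pos_weak_solution_cong:
  assumes "open \<Omega>" "\<And>s. s > 0 \<Longrightarrow> F s = F' s"
  shows "pos_weak_solution \<Omega> c F u \<longleftrightarrow> pos_weak_solution \<Omega> c F' u"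
proof -
  have "(LINT x:\<Omega>|lborel. F (u x) * \<phi> x) = (LINT x:\<Omega>|lborel. F' (u x) * \<phi> x)"
    if "\<forall>x\<in>\<Omega>. u x > 0" for \<phi>
    using assms that by (intro set_lebesgue_integral_cong) auto
  then show ?thesis unfolding pos_weak_solution_def by auto
qed

text \<open>
  The left-hand side of the equation is of degree \<open>1\<close> in the solution, the right-hand side of degree
  \<open>p - 1\<close>; the hypothesis on the constants balances the two.
\<close>

lemma pos_weak_solution_scale:
  assumes "open \<Omega>" "s > 0" "c \<noteq> 0" and eq: "c' * s * \<mu> = c * \<mu>' * s powr (p - 1)"
    and u: "pos_weak_solution \<Omega> c (\<lambda>y. \<mu> * y powr (p - 1)) u"
  shows "pos_weak_solution \<Omega> c' (\<lambda>y. \<mu>' * y powr (p - 1)) (\<lambda>x. s * u x)"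
proof -
  have uC: "u \<in> C10 \<Omega>" and pos: "\<And>x. x \<in> \<Omega> \<Longrightarrow> u x > 0"
    using u by (auto simp: pos_weak_solution_def)
  have "c' * (LINT x:\<Omega>|lborel. grad (\<lambda>x. s * u x) x \<bullet> grad \<phi> x)
      = (LINT x:\<Omega>|lborel. \<mu>' * (s * u x) powr (p - 1) * \<phi> x)" if \<phi>: "test_fun \<Omega> \<phi>" for \<phi>
  proof -
    let ?I = "LINT x:\<Omega>|lborel. grad u x \<bullet> grad \<phi> x"
    let ?J = "LINT x:\<Omega>|lborel. u x powr (p - 1) * \<phi> x"
    have "c * ?I = \<mu> * ?J"
      using u \<phi> by (simp add: pos_weak_solution_def mult.assoc)
    have "(LINT x:\<Omega>|lborel. grad (\<lambda>x. s * u x) x \<bullet> grad \<phi> x)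
        = (LINT x:\<Omega>|lborel. s * (grad u x \<bullet> grad \<phi> x))"
      using \<open>open \<Omega>\<close> by (intro set_lebesgue_integral_cong) (auto simp: grad_scale[OF uC])
    then have "c * (c' * (LINT x:\<Omega>|lborel. grad (\<lambda>x. s * u x) x \<bullet> grad \<phi> x)) = c' * s * (c * ?I)"
      by simp
    also have "\<dots> = c * (\<mu>' * s powr (p - 1) * ?J)"
      using \<open>c * ?I = \<mu> * ?J\<close> eq by (simp flip: mult.assoc)
    finally have "c' * (LINT x:\<Omega>|lborel. grad (\<lambda>x. s * u x) x \<bullet> grad \<phi> x)
        = \<mu>' * s powr (p - 1) * ?J"
      using \<open>c \<noteq> 0\<close> by (simp only: mult_cancel_left simp_thms)
    also have "\<dots> = (LINT x:\<Omega>|lborel. \<mu>' * s powr (p - 1) * (u x powr (p - 1) * \<phi> x))"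
      by (rule set_integral_mult_right[symmetric])
    also have "\<dots> = (LINT x:\<Omega>|lborel. \<mu>' * (s * u x) powr (p - 1) * \<phi> x)"
      using \<open>open \<Omega>\<close> \<open>s > 0\<close> pos
      by (intro set_lebesgue_integral_cong) (auto simp: powr_mult less_imp_le)
    finally show ?thesis .
  qed
  then show ?thesis
    using C10_scale[OF uC, of s] pos \<open>s > 0\<close> by (auto simp: pos_weak_solution_def)
qed

lemma emeasure_lebesgue_open_pos:
  fixes S :: "'a::euclidean_space set"
  assumes "open S" "S \<noteq> {}" shows "emeasure lebesgue S > 0"
proof -
  have "S \<in> sets lebesgue" using assms(1) by simp
  then show ?thesis
    using open_not_negligible[OF assms] negligible_iff_emeasure0[of S]
    by (simp add: zero_less_iff_neq_zero)
qed

text \<open>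
  Otherwise the function would be constant on the domain and, by continuity, equal to the same nonzero
  constant at a boundary point.
\<close>

lemma C10_grad_nonzero:
  fixes \<Omega> :: "'a::euclidean_space set"
  assumes \<Omega>: "open \<Omega>" "connected \<Omega>" "bounded \<Omega>" and u: "u \<in> C10 \<Omega>" and "z \<in> \<Omega>" "u z \<noteq> 0"
  obtains x where "x \<in> \<Omega>" "grad u x \<noteq> 0"
proof -
  have "False" if zero: "\<And>x. x \<in> \<Omega> \<Longrightarrow> grad u x = 0"
  proof -
    obtain G where G: "\<And>x. x \<in> \<Omega> \<Longrightarrow> GDERIV u x :> G x"
      using u by (auto simp: C10_def)
    have "(u has_derivative (\<lambda>h. 0)) (at x)" if "x \<in> \<Omega>" for x
      using G[OF that] grad_eq[OF G[OF that]] zero[OF that] by (simp add: gderiv_def)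
    then have const: "u x = u z" if "x \<in> \<Omega>" for x
      using \<open>z \<in> \<Omega>\<close> that by (intro has_derivative_zero_unique_connected[OF \<Omega>(1,2)])
    have "frontier \<Omega> \<noteq> {}"
      using \<open>z \<in> \<Omega>\<close> \<Omega>(3) not_bounded_UNIV unfolding frontier_eq_empty by blast
    then obtain b where b: "b \<in> closure \<Omega>" "b \<notin> \<Omega>"
      using \<Omega>(1) by (auto simp: frontier_def interior_open)
    have "continuous_on (closure \<Omega>) u" using u by (simp add: C10_def)
    from continuous_constant_on_closure[OF this const b(1)] have "u b = u z" .
    then show False using b(2) u \<open>u z \<noteq> 0\<close> by (simp add: C10_def)
  qed
  then show ?thesis using that by blast
qed

lemma filterlim_Suc_mult_at_top:
  assumes "(c::real) > 0" shows "filterlim (\<lambda>n. real (Suc n) * c) at_top sequentially"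
  using assms
  by (intro filterlim_at_top_mult_tendsto_pos[OF tendsto_const])
    (auto intro: filterlim_compose[OF filterlim_real_sequentially filterlim_Suc] simp del: of_nat_Suc)

text \<open>
  If \<open>g u = 0\<close>, then \<open>g\<close> vanishes on the whole ray through \<open>u\<close>, while the multiples \<open>n * u\<close> blow up
  on all of \<open>\<Omega>\<close>, and their gradients on the nonempty open set where the gradient of \<open>u\<close> is nonzero. Either
  coercivity condition excludes this.
\<close>

lemma coercive_homogeneous_pos:
  fixes \<Omega> :: "'a::euclidean_space set"
  assumes \<Omega>: "open \<Omega>" "connected \<Omega>" "bounded \<Omega>" "\<Omega> \<noteq> {}"
    and g_nonneg: "\<And>u. u \<in> C10 \<Omega> \<Longrightarrow> g u \<ge> 0"
    and g_coercive: "cond_g1 \<Omega> g \<or> cond_g2 \<Omega> g"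
    and g_hom: "\<And>s u. s > 0 \<Longrightarrow> u \<in> C10 \<Omega> \<Longrightarrow> g (\<lambda>x. s * u x) = s powr \<gamma> * g u"
    and u: "u \<in> C10 \<Omega>" "\<And>x. x \<in> \<Omega> \<Longrightarrow> u x > 0"
  shows "g u > 0"
proof (rule ccontr)
  assume "\<not> g u > 0"
  then have "g u = 0" using g_nonneg[OF u(1)] by simp
  define U where "U n = (\<lambda>x. real (Suc n) * u x)" for n
  have U: "U n \<in> C10 \<Omega>" for n
    unfolding U_def by (rule C10_scale[OF u(1)])
  have "g (U n) = 0" for n
    unfolding U_def using g_hom[of "real (Suc n)" u] u(1) \<open>g u = 0\<close> by simp
  then have "\<not> (\<forall>\<^sub>F n in sequentially. 1 \<le> g (U n))" by simp
  then have not_lim: "\<not> filterlim (\<lambda>n. g (U n)) at_top sequentially"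
    unfolding filterlim_at_top by blast
  from g_coercive show False
  proof
    assume g1: "cond_g1 \<Omega> g"
    have "filterlim (\<lambda>n. \<bar>U n x\<bar>) at_top sequentially" if "x \<in> \<Omega>" for x
      using filterlim_Suc_mult_at_top[OF u(2)[OF that]] u(2)[OF that]
      by (simp add: U_def abs_mult del: of_nat_Suc)
    moreover have "\<Omega> \<in> sets lebesgue" using \<Omega>(1) by simp
    ultimately show False
      using g1[unfolded cond_g1_def, rule_format, of U] U not_lim
        emeasure_lebesgue_open_pos[OF \<Omega>(1,4)] by blast
  next
    assume g2: "cond_g2 \<Omega> g"
    obtain z where "z \<in> \<Omega>" using \<Omega>(4) by blast
    then obtain y where y: "y \<in> \<Omega>" "grad u y \<noteq> 0"
      using C10_grad_nonzero[OF \<Omega>(1-3) u(1), of z] u(2)[of z] by auto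
    obtain G where G: "continuous_on (closure \<Omega>) G" "\<And>x. x \<in> \<Omega> \<Longrightarrow> GDERIV u x :> G x"
      using u(1) by (auto simp: C10_def)
    have grad: "grad u x = G x" if "x \<in> \<Omega>" for x
      using G(2)[OF that] by (rule grad_eq)
    define S where "S = G -` (- {0}) \<inter> \<Omega>"
    have "continuous_on \<Omega> G"
      using G(1) closure_subset by (rule continuous_on_subset)
    then have "open S"
      unfolding S_def using \<Omega>(1) by (simp add: continuous_on_open_vimage open_Compl)
    moreover have "S \<noteq> {}" using y grad by (auto simp: S_def)
    ultimately have "emeasure lebesgue S > 0" "S \<in> sets lebesgue"
      by (rule emeasure_lebesgue_open_pos) (simp add: \<open>open S\<close>)
    moreover have "filterlim (\<lambda>n. norm (grad (U n) x)) at_top sequentially" if "x \<in> S" for x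
    proof -
      have "x \<in> \<Omega>" "norm (grad u x) > 0" using that grad by (auto simp: S_def)
      then show ?thesis
        using filterlim_Suc_mult_at_top[of "norm (grad u x)"]
        by (simp add: U_def grad_scale[OF u(1)] del: of_nat_Suc)
    qed
    moreover have "S \<subseteq> \<Omega>" by (simp add: S_def)
    ultimately show False
      using g2[unfolded cond_g2_def, rule_format, of U] U not_lim by blast
  qed
qed

text \<open>
  The reduction to one real unknown. On the level \<open>g u = \<alpha>\<close> the coefficient \<open>a (g u)\<close> is the constant
  \<open>c = a \<alpha>\<close>. A solution rescaled by \<open>\<tau> = (c / lam) powr (1 / (2 - p))\<close> solves the model equation and
  so equals \<open>v\<close>; the level \<open>\<alpha>\<close> then fixes \<open>\<tau>\<close>, which in turn fixes \<open>lam\<close>.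
\<close>

lemma solution_ray:
  fixes \<Omega> :: "'a::euclidean_space set"
  assumes \<Omega>: "open \<Omega>" "bounded \<Omega>" and "p < 2" "\<gamma> > 0"
    and g_hom: "\<And>s u. s > 0 \<Longrightarrow> u \<in> C10 \<Omega> \<Longrightarrow> g (\<lambda>x. s * u x) = s powr \<gamma> * g u"
    and v: "pos_weak_solution \<Omega> 1 (\<lambda>s. s powr (p - 1)) v" and "g v > 0"
    and pos: "\<alpha> > 0" "c > 0" "lam > 0"
  shows "pos_weak_solution \<Omega> c (\<lambda>s. lam * s powr (p - 1)) u \<and> g u = \<alpha> \<longleftrightarrow>
    u = (\<lambda>x. (\<alpha> / g v) powr (1 / \<gamma>) * v x) \<and>
    lam = g v powr ((p - 2) / \<gamma>) * (c * \<alpha> powr ((2 - p) / \<gamma>))"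
    (is "?L \<longleftrightarrow> ?R")
proof -
  define s where "s = (\<alpha> / g v) powr (1 / \<gamma>)"
  have s: "s > 0" using pos \<open>g v > 0\<close> by (simp add: s_def)
  have s_\<gamma>: "s powr \<gamma> * g v = \<alpha>"
    using pos \<open>g v > 0\<close> \<open>\<gamma> > 0\<close> by (simp add: s_def powr_powr)
  have vC: "v \<in> C10 \<Omega>" using v by (simp add: pos_weak_solution_def)
  have lam_eq: "g v powr ((p - 2) / \<gamma>) * (c * \<alpha> powr ((2 - p) / \<gamma>)) = c * s powr (2 - p)"
  proof -
    have "s powr (2 - p) = \<alpha> powr ((2 - p) / \<gamma>) / g v powr ((2 - p) / \<gamma>)"
      by (simp add: s_def powr_powr powr_divide)
    moreover have "g v powr ((p - 2) / \<gamma>) = 1 / g v powr ((2 - p) / \<gamma>)"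
    proof -
      have "(p - 2) / \<gamma> = - ((2 - p) / \<gamma>)" by (metis minus_diff_eq minus_divide_left)
      then show ?thesis by (simp only: powr_minus_divide)
    qed
    ultimately show ?thesis by simp
  qed
  have powr_split: "y powr (2 - p) * y powr (p - 1) = y" if "y > 0" for y :: real
    using that by (simp flip: powr_add)
  have "?L" if ?R
  proof -
    have u: "u = (\<lambda>x. s * v x)" and lam: "lam = c * s powr (2 - p)"
      using that unfolding lam_eq s_def[symmetric] by blast+
    have "pos_weak_solution \<Omega> c (\<lambda>y. lam * y powr (p - 1)) u"
      unfolding u
    proof (rule pos_weak_solution_scale[OF \<Omega>(1) s, where c = 1 and \<mu> = 1])
      show "c * s * 1 = 1 * lam * s powr (p - 1)"
        using powr_split[OF s] by (simp add: lam mult.assoc)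
    qed (use v in auto)
    then show ?L using u g_hom[OF s vC] s_\<gamma> by simp
  qed
  moreover have "?R" if ?L
  proof -
    have u: "pos_weak_solution \<Omega> c (\<lambda>s. lam * s powr (p - 1)) u" and gu: "g u = \<alpha>"
      using that by auto
    have uC: "u \<in> C10 \<Omega>" using u by (simp add: pos_weak_solution_def)
    define \<tau> where "\<tau> = (c / lam) powr (1 / (2 - p))"
    have \<tau>: "\<tau> > 0" using pos by (simp add: \<tau>_def)
    have \<tau>_p: "\<tau> powr (2 - p) = c / lam"
      using pos \<open>p < 2\<close> by (simp add: \<tau>_def powr_powr)
    have "pos_weak_solution \<Omega> 1 (\<lambda>y. 1 * y powr (p - 1)) (\<lambda>x. \<tau> * u x)"
    proof (rule pos_weak_solution_scale[OF \<Omega>(1) \<tau> _ _ u])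
      have "\<tau> = c / lam * \<tau> powr (p - 1)"
        using powr_split[OF \<tau>] \<tau>_p by simp
      then show "1 * \<tau> * lam = c * 1 * \<tau> powr (p - 1)"
        using pos by (simp add: field_simps)
    qed (use pos in simp)
    then have \<tau>u: "v = (\<lambda>x. \<tau> * u x)"
      using v by (intro pos_weak_solution_unique[OF \<Omega> \<open>p < 2\<close>]) auto
    then have "g v = \<tau> powr \<gamma> * \<alpha>"
      using g_hom[OF \<tau> uC] gu by simp
    then have "\<alpha> / g v = (1 / \<tau>) powr \<gamma>"
      using pos \<tau> by (simp add: powr_divide)
    then have s_\<tau>: "s = 1 / \<tau>"
      using \<tau> \<open>\<gamma> > 0\<close> by (simp add: s_def powr_powr)
    have "u = (\<lambda>x. s * v x)"
      using \<tau> by (subst \<tau>u) (simp add: s_\<tau>)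
    moreover have "lam = c * s powr (2 - p)"
      using \<tau>_p pos \<tau> by (simp add: s_\<tau> powr_divide)
    ultimately show ?R unfolding lam_eq s_def[symmetric] by blast
  qed
  ultimately show ?thesis by blast
qed

section \<open>Level sets of functions vanishing at both ends of an interval\<close>

lemma hump_attains_sup:
  fixes h :: "real \<Rightarrow> real"
  assumes "l < r" "continuous_on {l..r} h" "h l = 0" "h r = 0"
    and pos: "\<And>x. l < x \<Longrightarrow> x < r \<Longrightarrow> h x > 0"
  obtains x where "l < x" "x < r" "h x = (SUP y\<in>{l..r}. h y)"
    "\<And>y. y \<in> {l..r} \<Longrightarrow> h y \<le> h x"
proof -
  obtain x where x: "x \<in> {l..r}" and max: "\<And>y. y \<in> {l..r} \<Longrightarrow> h y \<le> h x"
    using continuous_attains_sup[of "{l..r}" h] assms by auto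
  have "h x > 0"
    using max[of "(l + r) / 2"] pos[of "(l + r) / 2"] \<open>l < r\<close> by auto
  then have "l < x" "x < r"
    using x assms by (auto simp: less_le)
  moreover have "h x = (SUP y\<in>{l..r}. h y)"
    using x max by (intro cSup_eq_maximum[symmetric]) auto
  ultimately show ?thesis using max that by blast
qed

lemma hump_two_preimages:
  fixes h :: "real \<Rightarrow> real"
  assumes "continuous_on {l..r} h" "h l = 0" "h r = 0" "l < m" "m < r" "0 < c" "c < h m"
  obtains x y where "l < x" "x < y" "y < r" "h x = c" "h y = c"
proof -
  obtain x where x: "l \<le> x" "x \<le> m" "h x = c"
    using IVT'[of h l c m] assms continuous_on_subset[OF assms(1), of "{l..m}"] by auto
  obtain y where y: "m \<le> y" "y \<le> r" "h y = c"
    using IVT2'[of h r c m] assms continuous_on_subset[OF assms(1), of "{m..r}"] by auto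
  have "x \<noteq> l" "x \<noteq> m" "y \<noteq> m" "y \<noteq> r"
    using x y assms by auto
  with x y that[of x y] show ?thesis by auto
qed

lemma strictly_concave_pos_between_zeros:
  assumes "strictly_concave_on S \<psi>" "x \<in> S" "z \<in> S" "x < y" "y < z" "\<psi> x = 0" "\<psi> z = 0"
  shows "\<psi> y > 0"
proof -
  define \<theta> where "\<theta> = (y - x) / (z - x)"
  have \<theta>: "0 < \<theta>" "\<theta> < 1" using assms by (auto simp: \<theta>_def)
  have "(1 - \<theta>) * x + \<theta> * z = x + \<theta> * (z - x)" by (simp add: algebra_simps)
  also have "\<dots> = y" using assms by (simp add: \<theta>_def)
  finally have y: "(1 - \<theta>) * x + \<theta> * z = y" .
  have "x \<noteq> z" using assms by simp
  then have "(1 - \<theta>) * \<psi> x + \<theta> * \<psi> z < \<psi> ((1 - \<theta>) * x + \<theta> * z)"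
    using assms(1-3) \<theta> unfolding strictly_concave_on_def by blast
  then show ?thesis using assms y by simp
qed

lemma strictly_concave_minus_convex:
  assumes "strictly_concave_on S h" "convex_on S k"
  shows "strictly_concave_on S (\<lambda>x. h x - k x)"
  unfolding strictly_concave_on_def
proof (intro conjI ballI allI impI)
  show "convex S" using assms(1) by (simp add: strictly_concave_on_def)
  fix x y \<theta> :: real assume *: "x \<in> S" "y \<in> S" "x \<noteq> y \<and> 0 < \<theta> \<and> \<theta> < 1"
  have "(1 - \<theta>) * h x + \<theta> * h y < h ((1 - \<theta>) * x + \<theta> * y)"
    using assms(1) * unfolding strictly_concave_on_def by blast
  moreover have "k ((1 - \<theta>) * x + \<theta> * y) \<le> (1 - \<theta>) * k x + \<theta> * k y"
    using convex_onD[OF assms(2), of \<theta> x y] * by simp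
  ultimately show "(1 - \<theta>) * (h x - k x) + \<theta> * (h y - k y)
      < h ((1 - \<theta>) * x + \<theta> * y) - k ((1 - \<theta>) * x + \<theta> * y)"
    by (simp add: algebra_simps)
qed

lemma convex_on_powr_neg:
  fixes c \<sigma> :: real
  assumes "c \<ge> 0" "\<sigma> \<ge> 0"
  shows "convex_on {0<..} (\<lambda>x. c * x powr (- \<sigma>))"
proof (rule convex_on_realI)
  show "((\<lambda>x. c * x powr (- \<sigma>)) has_real_derivative c * (- \<sigma> * x powr (- \<sigma> - 1))) (at x)"
    if "x \<in> {0<..}" for x
    using that by (auto intro!: derivative_eq_intros)
  show "c * (- \<sigma> * x powr (- \<sigma> - 1)) \<le> c * (- \<sigma> * y powr (- \<sigma> - 1))"
    if "x \<in> {0<..}" "y \<in> {0<..}" "x \<le> y" for x y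
    using that assms by (intro mult_left_mono mult_left_mono_neg powr_mono2') auto
qed (simp add: connected_Ioi)

text \<open>
  Under either concavity hypothesis the level set of \<open>a \<alpha> * \<alpha> powr \<sigma>\<close> at height \<open>c\<close> is the zero set of
  a strictly concave function with the same sign pattern. If \<open>a\<close> itself is concave, the product need
  not be; but division by \<open>\<alpha> powr \<sigma>\<close> turns the constant into the convex function
  \<open>c * \<alpha> powr (- \<sigma>)\<close>, and \<open>a \<alpha> - c * \<alpha> powr (- \<sigma>)\<close> is strictly concave.
\<close>

lemma weighted_level_concave:
  fixes a :: "real \<Rightarrow> real"
  assumes "l \<ge> 0" "\<sigma> > 0" "c > 0"
    and conc: "strictly_concave_on {l<..<r} a \<or> strictly_concave_on {l<..<r} (\<lambda>\<alpha>. \<alpha> powr \<sigma> * a \<alpha>)"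
  obtains \<psi> where "strictly_concave_on {l<..<r} \<psi>"
    "\<And>\<alpha>. \<alpha> \<in> {l<..<r} \<Longrightarrow> sgn (\<psi> \<alpha>) = sgn (a \<alpha> * \<alpha> powr \<sigma> - c)"
  using conc
proof
  assume a: "strictly_concave_on {l<..<r} a"
  show thesis
  proof (rule that)
    have "convex_on {l<..<r} (\<lambda>x. c * x powr (- \<sigma>))"
      using assms by (intro convex_on_subset[OF convex_on_powr_neg]) auto
    with a show "strictly_concave_on {l<..<r} (\<lambda>\<alpha>. a \<alpha> - c * \<alpha> powr (- \<sigma>))"
      by (rule strictly_concave_minus_convex)
    show "sgn (a \<alpha> - c * \<alpha> powr (- \<sigma>)) = sgn (a \<alpha> * \<alpha> powr \<sigma> - c)" if "\<alpha> \<in> {l<..<r}" for \<alpha>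
    proof -
      have "\<alpha> > 0" using that assms by auto
      then have "a \<alpha> * \<alpha> powr \<sigma> - c = \<alpha> powr \<sigma> * (a \<alpha> - c * \<alpha> powr (- \<sigma>))"
        by (simp add: algebra_simps flip: powr_add)
      then show ?thesis using \<open>\<alpha> > 0\<close> by (simp add: sgn_mult)
    qed
  qed
next
  assume h: "strictly_concave_on {l<..<r} (\<lambda>\<alpha>. \<alpha> powr \<sigma> * a \<alpha>)"
  show thesis
  proof (rule that)
    have "convex_on {l<..<r} (\<lambda>_. c)"
      by (simp add: convex_on_const)
    with h show "strictly_concave_on {l<..<r} (\<lambda>\<alpha>. \<alpha> powr \<sigma> * a \<alpha> - c)"
      by (rule strictly_concave_minus_convex)
  qed (simp add: mult.commute)
qed

section \<open>Counting solutions\<close>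

theorem theorem1p4:
  fixes \<Omega> :: "(real ^ 'n) set"
    and a f :: "real \<Rightarrow> real"
    and g :: "(real ^ 'n \<Rightarrow> real) \<Rightarrow> real"
    and p \<gamma> :: real
    and k i :: nat
    and t :: "nat \<Rightarrow> real"
    and v :: "real ^ 'n \<Rightarrow> real"
  assumes domain: "bounded_smooth_domain \<Omega>"
    and a_cont: "continuous_on {0..} a"
    and a_nonneg: "\<And>s. s \<ge> 0 \<Longrightarrow> a s \<ge> 0"
    and g_cont: "continuous_functional \<Omega> g"
    and g_nonneg: "\<And>u. u \<in> C10 \<Omega> \<Longrightarrow> g u \<ge> 0"
    and g_zero: "g (\<lambda>x. 0) = 0"
    and g_coercive: "cond_g1 \<Omega> g \<or> cond_g2 \<Omega> g"
    and p: "p < 2"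
    and f: "\<And>s. s > 0 \<Longrightarrow> f s = s powr (p - 1)"
    and t_zero: "t 0 = 0"
    and t_less: "\<And>j. j < k \<Longrightarrow> t j < t (Suc j)"
    and a_zero: "\<And>j. 1 \<le> j \<Longrightarrow> j \<le> k \<Longrightarrow> a (t j) = 0"
    and a_pos: "\<And>j s. j < k \<Longrightarrow> t j < s \<Longrightarrow> s < t (Suc j) \<Longrightarrow> a s > 0"
    and gamma: "\<gamma> > 0"
    and g_hom: "\<And>s u. s > 0 \<Longrightarrow> u \<in> C10 \<Omega> \<Longrightarrow> g (\<lambda>x. s * u x) = s powr \<gamma> * g u"
    and v: "pos_weak_solution \<Omega> 1 (\<lambda>s. s powr (p - 1)) v"
    and i: "i < k"
  defines "sols \<equiv> \<lambda>lam. {u. solves_Pg \<Omega> a g lam f u \<and> t i < g u \<and> g u < t (Suc i)}"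
    and "lam0 \<equiv> lambda0 p \<gamma> a (g v) (t i) (t (Suc i))"
  shows "(\<forall>lam. 0 < lam \<and> lam < lam0 \<longrightarrow> (\<exists>u1 u2. u1 \<noteq> u2 \<and> u1 \<in> sols lam \<and> u2 \<in> sols lam)) \<and>
    (\<exists>u. u \<in> sols lam0) \<and>
    (\<forall>lam>lam0. sols lam = {}) \<and>
    (strictly_concave_on {t i<..<t (Suc i)} a \<or>
       strictly_concave_on {t i<..<t (Suc i)} (\<lambda>\<alpha>. \<alpha> powr ((2 - p) / \<gamma>) * a \<alpha>) \<longrightarrow>
     (\<forall>lam. 0 < lam \<and> lam < lam0 \<longrightarrow> (\<exists>u1 u2. u1 \<noteq> u2 \<and> sols lam = {u1, u2})) \<and>
     (\<exists>u. sols lam0 = {u}))"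
proof -
  define l where "l = t i"
  define r where "r = t (Suc i)"
  define \<sigma> where "\<sigma> = (2 - p) / \<gamma>"
  define h where "h \<alpha> = a \<alpha> * \<alpha> powr \<sigma>" for \<alpha>
  define K where "K = g v powr ((p - 2) / \<gamma>)"
  define M where "M = (SUP \<alpha>\<in>{l..r}. h \<alpha>)"
  define ray where "ray \<alpha> = (\<lambda>x. (\<alpha> / g v) powr (1 / \<gamma>) * v x)" for \<alpha>
  have \<Omega>: "open \<Omega>" "connected \<Omega>" "bounded \<Omega>" "\<Omega> \<noteq> {}"
    using domain by (simp_all add: bounded_smooth_domain_def)
  have vC: "v \<in> C10 \<Omega>" and v_pos: "\<And>x. x \<in> \<Omega> \<Longrightarrow> v x > 0"
    using v by (auto simp: pos_weak_solution_def)
  have gv: "g v > 0"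
    using coercive_homogeneous_pos[OF \<Omega> g_nonneg g_coercive g_hom vC v_pos] .
  have K: "K > 0" using gv by (simp add: K_def)
  have \<sigma>: "\<sigma> > 0" using p gamma by (simp add: \<sigma>_def)
  have "t j \<ge> 0" if "j \<le> k" for j
    using that by (induction j) (use t_zero t_less in \<open>auto simp: less_imp_le Suc_le_eq intro: order_trans\<close>)
  then have l: "l \<ge> 0" using i by (simp add: l_def)
  have lr: "l < r" using t_less[OF i] by (simp add: l_def r_def)
  have h_pos: "h \<alpha> > 0" if "l < \<alpha>" "\<alpha> < r" for \<alpha>
    using a_pos[OF i] that l by (simp add: h_def l_def r_def)
  have h_l: "h l = 0"
    using t_zero a_zero[of i] i by (cases i) (auto simp: h_def l_def)
  have h_r: "h r = 0"
    using a_zero[of "Suc i"] i by (simp add: h_def r_def)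
  have h_cont: "continuous_on {l..r} h"
    unfolding h_def
  proof (intro continuous_on_mult continuous_on_powr' continuous_on_id continuous_on_const ballI)
    show "continuous_on {l..r} a"
      using l by (intro continuous_on_subset[OF a_cont]) auto
  qed (use l \<sigma> in auto)
  have lam0: "lam0 = K * M"
    by (simp add: lam0_def lambda0_def K_def M_def h_def \<sigma>_def l_def r_def)
  obtain m where m: "l < m" "m < r" "h m = M" and max: "\<And>\<alpha>. \<alpha> \<in> {l..r} \<Longrightarrow> h \<alpha> \<le> h m"
    using hump_attains_sup[OF lr h_cont h_l h_r h_pos] unfolding M_def by blast
  have M: "M > 0" using h_pos[OF m(1,2)] m(3) by simp
  have lam0_pos: "lam0 > 0" using K M by (simp add: lam0)
  have iff: "pos_weak_solution \<Omega> (a \<alpha>) (\<lambda>s. lam * s powr (p - 1)) u \<and> g u = \<alpha> \<longleftrightarrow>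
      u = ray \<alpha> \<and> lam = K * h \<alpha>"
    if "lam > 0" "l < \<alpha>" "\<alpha> < r" for lam \<alpha> u
  proof -
    have "\<alpha> > 0" "a \<alpha> > 0"
      using l that a_pos[OF i, of \<alpha>] by (auto simp: l_def r_def)
    from solution_ray[OF \<Omega>(1,3) p gamma g_hom v gv this that(1)]
    show ?thesis by (simp add: ray_def K_def h_def \<sigma>_def)
  qed
  have sols: "sols lam = ray ` {\<alpha> \<in> {l<..<r}. K * h \<alpha> = lam}" if "lam > 0" for lam
  proof -
    have "u \<in> sols lam \<longleftrightarrow> u \<in> ray ` {\<alpha> \<in> {l<..<r}. K * h \<alpha> = lam}" for u
    proof -
      have "solves_Pg \<Omega> a g lam f u \<longleftrightarrow>
          pos_weak_solution \<Omega> (a (g u)) (\<lambda>s. lam * s powr (p - 1)) u"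
        unfolding solves_Pg_def using f by (intro pos_weak_solution_cong[OF \<Omega>(1)]) simp
      then have "u \<in> sols lam \<longleftrightarrow> (\<exists>\<alpha>\<in>{l<..<r}.
          pos_weak_solution \<Omega> (a \<alpha>) (\<lambda>s. lam * s powr (p - 1)) u \<and> g u = \<alpha>)"
        by (auto simp: sols_def l_def r_def)
      also have "\<dots> \<longleftrightarrow> (\<exists>\<alpha>\<in>{l<..<r}. u = ray \<alpha> \<and> lam = K * h \<alpha>)"
        by (intro bex_cong[OF refl] iff[OF that]) auto
      finally show ?thesis by auto
    qed
    then show ?thesis by blast
  qed
  have ray_inj: "inj_on ray {l<..<r}"
  proof (rule inj_on_inverseI[where g = g])
    fix \<alpha> assume "\<alpha> \<in> {l<..<r}"
    then show "g (ray \<alpha>) = \<alpha>"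
      using iff[of "K * h \<alpha>" \<alpha> "ray \<alpha>"] K h_pos[of \<alpha>] by auto
  qed
  have two: "\<exists>x y. l < x \<and> x < y \<and> y < r \<and> K * h x = lam \<and> K * h y = lam"
    if "0 < lam" "lam < lam0" for lam
  proof -
    have "0 < lam / K" "lam / K < h m"
      using that K m(3) by (auto simp: lam0 field_simps)
    from hump_two_preimages[OF h_cont h_l h_r m(1,2) this]
    obtain x y where "l < x" "x < y" "y < r" "h x = lam / K" "h y = lam / K" .
    then show ?thesis using K by (intro exI[of _ x] exI[of _ y]) simp
  qed
  have at_least_two: "\<exists>u1 u2. u1 \<noteq> u2 \<and> u1 \<in> sols lam \<and> u2 \<in> sols lam" if lam: "0 < lam" "lam < lam0" for lam
  proof -
    obtain x y where xy: "l < x" "x < y" "y < r" "K * h x = lam" "K * h y = lam"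
      using two[OF lam] by blast
    then have "ray x \<noteq> ray y"
      using inj_onD[OF ray_inj, of x y] by auto
    moreover have "ray x \<in> sols lam" "ray y \<in> sols lam"
      unfolding sols[OF lam(1)] using xy by auto
    ultimately show ?thesis by blast
  qed
  have at_least_one: "ray m \<in> sols lam0"
    unfolding sols[OF lam0_pos] using m by (auto simp: lam0)
  have none: "sols lam = {}" if "lam > lam0" for lam
  proof -
    have "K * h \<alpha> \<le> lam0" if "\<alpha> \<in> {l<..<r}" for \<alpha>
      using max[of \<alpha>] that K m(3) by (simp add: lam0)
    then show ?thesis
      using that lam0_pos by (subst sols) force+
  qed
  have exactly: "(\<forall>lam. 0 < lam \<and> lam < lam0 \<longrightarrow> (\<exists>u1 u2. u1 \<noteq> u2 \<and> sols lam = {u1, u2})) \<and>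
      (\<exists>u. sols lam0 = {u})"
    if conc: "strictly_concave_on {l<..<r} a \<or> strictly_concave_on {l<..<r} (\<lambda>\<alpha>. \<alpha> powr \<sigma> * a \<alpha>)"
  proof -
    \<comment> \<open>Strictly between two points of a level set, K * h lies above the level: this rules out a third
      point, and a second point at the maximal level.\<close>
    have between: "K * h y > lam"
      if "lam > 0" "l < x" "x < y" "y < z" "z < r" "K * h x = lam" "K * h z = lam" for lam x y z
    proof -
      have "lam / K > 0" using that K by simp
      from weighted_level_concave[OF l \<sigma> this conc]
      obtain \<psi> where \<psi>: "strictly_concave_on {l<..<r} \<psi>"
        and sgn: "\<And>\<alpha>. \<alpha> \<in> {l<..<r} \<Longrightarrow> sgn (\<psi> \<alpha>) = sgn (a \<alpha> * \<alpha> powr \<sigma> - lam / K)"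
        by blast
      have sgn: "sgn (\<psi> \<alpha>) = sgn (K * h \<alpha> - lam)" if "\<alpha> \<in> {l<..<r}" for \<alpha>
      proof -
        have "K * h \<alpha> - lam = K * (a \<alpha> * \<alpha> powr \<sigma> - lam / K)"
          using K by (simp add: h_def field_simps)
        then show ?thesis using sgn[OF that] K by (simp add: sgn_mult)
      qed
      have "\<psi> x = 0" "\<psi> z = 0"
        using sgn[of x] sgn[of z] that by (auto simp: sgn_0_0)
      then have "\<psi> y > 0"
        using that by (intro strictly_concave_pos_between_zeros[OF \<psi>, of x z]) auto
      then have "sgn (K * h y - lam) = 1"
        using sgn[of y] that by simp
      then show ?thesis by (simp add: sgn_1_pos)
    qed
    have pair: "\<exists>u1 u2. u1 \<noteq> u2 \<and> sols lam = {u1, u2}" if lam: "0 < lam" "lam < lam0" for lam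
    proof -
      obtain x y where xy: "l < x" "x < y" "y < r" "K * h x = lam" "K * h y = lam"
        using two[OF lam] by blast
      have "z = x \<or> z = y" if z: "l < z" "z < r" "K * h z = lam" for z
        using between[OF lam(1), of z x y] between[OF lam(1), of x z y]
          between[OF lam(1), of x y z] xy z by (cases z x rule: linorder_cases; cases z y rule: linorder_cases) auto
      then have "{\<alpha> \<in> {l<..<r}. K * h \<alpha> = lam} = {x, y}"
        using xy by auto
      then have "sols lam = {ray x, ray y}"
        unfolding sols[OF lam(1)] by simp
      moreover have "ray x \<noteq> ray y"
        using inj_onD[OF ray_inj, of x y] xy by auto
      ultimately show ?thesis by blast
    qed
    have single: "sols lam0 = {ray m}"
    proof -
      have not_less: "\<not> x < y" if "l < x" "y < r" "K * h x = lam0" "K * h y = lam0" for x y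
      proof
        assume "x < y"
        then have "lam0 < K * h ((x + y) / 2)"
          using that by (intro between[OF lam0_pos, of x _ y]) auto
        moreover have "h ((x + y) / 2) \<le> M"
          using max[of "(x + y) / 2"] m(3) that \<open>x < y\<close> by simp
        ultimately show False using K by (simp add: lam0)
      qed
      have m_level: "K * h m = lam0" using m(3) by (simp add: lam0)
      then have uniq: "z = m" if "l < z" "z < r" "K * h z = lam0" for z
        using not_less[of z m] not_less[of m z] that m(1,2) by linarith
      have "{\<alpha> \<in> {l<..<r}. K * h \<alpha> = lam0} \<subseteq> {m}"
      proof
        fix z assume "z \<in> {\<alpha> \<in> {l<..<r}. K * h \<alpha> = lam0}"
        then have "z = m" by (intro uniq) auto
        then show "z \<in> {m}" by blast
      qed
      moreover have "m \<in> {\<alpha> \<in> {l<..<r}. K * h \<alpha> = lam0}"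
        using m_level m(1,2) by simp
      ultimately have "{\<alpha> \<in> {l<..<r}. K * h \<alpha> = lam0} = {m}" by blast
      then show ?thesis
        unfolding sols[OF lam0_pos] by simp
    qed
    show ?thesis
    proof (intro conjI allI impI)
      show "\<exists>u1 u2. u1 \<noteq> u2 \<and> sols lam = {u1, u2}" if "0 < lam \<and> lam < lam0" for lam
        using that by (intro pair) simp_all
      show "\<exists>u. sols lam0 = {u}" by (rule exI[of _ "ray m"]) (rule single)
    qed
  qed
  show ?thesis
  proof (intro conjI)
    show "\<forall>lam. 0 < lam \<and> lam < lam0 \<longrightarrow> (\<exists>u1 u2. u1 \<noteq> u2 \<and> u1 \<in> sols lam \<and> u2 \<in> sols lam)"
      using at_least_two by simp
    show "\<exists>u. u \<in> sols lam0" by (rule exI[of _ "ray m"]) (rule at_least_one)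
    show "\<forall>lam>lam0. sols lam = {}" using none by simp
  qed (rule impI, rule exactly[unfolded l_def r_def \<sigma>_def], assumption)
qed

end
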